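(* Fix any integer $k \geqslant 2$. Then, as the positive integer $q \to +\infty$, we have $$\dim_{\mathbb{Q}} V_k^{-}(q) \geqslant \left(\frac{1}{\log 2} - o(1)\right)\cdot \log q,$$ where $o(1)$ denotes a quantity (depending on $k$ and $q$) which tends to $0$ as $q\to+\infty$ with $k$ fixed.
   Context: For a real number $0<x\leqslant 1$, the Hurwitz zeta function is $\zeta(s,x)=\sum_{m=0}^{+\infty}\frac{1}{(m+x)^s}$, $\operatorname{Re}(s)>1$. For integers $k\geqslant 2$, $q\geqslant 3$ and $a\in\{1,\ldots,q-1\}$, put $$\zeta^{-}\left(k,\frac aq\right):=\zeta\left(k,\frac aq\right)-(-1)^k\zeta\left(k,1-\frac aq\right),$$ and define the $\mathbb{Q}$-linear subspace of $\mathbb{R}$ $$V_k^{-}(q):=\operatorname{Span}_{\mathbb{Q}}\left\{\zeta^{-}\left(k,\frac aq\right)\ \Big|\ 1\leqslant a<\frac q2,\ \gcd(a,q)=1\right\}.$$ *)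

theory Defs
  imports "HOL-Analysis.Analysis"
begin

text \<open>
  Only meant for \<open>0 < x \<le> 1\<close> and \<open>Re s > 1\<close>. The type of \<open>s\<close> is left polymorphic so that the one
  series covers both complex \<open>s\<close> and, with real values, real \<open>s\<close>; the two agree
  by \<open>hurwitz_zeta_of_real\<close> below.
\<close>

definition hurwitz_zeta :: "'a :: {ln, real_normed_field} \<Rightarrow> real \<Rightarrow> 'a" where
  "hurwitz_zeta s x = (\<Sum>m. 1 / (of_real (real m + x) powr s))"

lemma summable_hurwitz_zeta:
  fixes s x :: real
  assumes "s > 1" "x > 0"
  shows "summable (\<lambda>m. 1 / ((real m + x) powr s))"
proof (rule summable_comparison_test)
  show "summable (\<lambda>m. real m powr (- s))"
    using assms by (simp add: summable_real_powr_iff)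
  have "norm (1 / ((real m + x) powr s)) \<le> real m powr (- s)" if "m \<ge> 1" for m
  proof -
    have "real m powr s \<le> (real m + x) powr s"
      using assms that by (intro powr_mono2) auto
    moreover have "real m powr s > 0"
      using that by simp
    ultimately show ?thesis
      by (simp add: powr_minus_divide frac_le)
  qed
  then show "\<exists>N. \<forall>m\<ge>N. norm (1 / ((real m + x) powr s)) \<le> real m powr (- s)"
    by blast
qed

lemma hurwitz_zeta_of_real:
  fixes s x :: real
  assumes "s > 1" "x > 0"
  shows "hurwitz_zeta (of_real s :: complex) x = of_real (hurwitz_zeta s x)"
proof -
  have eq: "1 / (of_real (real m + x) powr (of_real s :: complex)) =
            of_real (1 / ((real m + x) powr s))" for m
    using assms by (subst powr_of_real) (auto simp del: of_real_add)
  show ?thesis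
    unfolding hurwitz_zeta_def eq
    using suminf_of_real[OF summable_hurwitz_zeta[OF assms], where ?'a = complex] by simp
qed

lemma hurwitz_zeta_of_nat:
  fixes x :: real
  assumes "x > 0"
  shows "hurwitz_zeta (real k) x = (\<Sum>m. 1 / (real m + x) ^ k)"
  using assms by (simp add: hurwitz_zeta_def powr_realpow add_nonneg_pos)

definition hurwitz_zeta_minus :: "nat \<Rightarrow> real \<Rightarrow> real" where
  "hurwitz_zeta_minus k x = hurwitz_zeta (real k) x - (-1) ^ k * hurwitz_zeta (real k) (1 - x)"

global_interpretation real_over_rat: vector_space "\<lambda>(r::rat) (x::real). of_rat r * x"
  defines rat_span = real_over_rat.span
    and rat_dim = real_over_rat.dim
  by unfold_locales (auto simp: algebra_simps of_rat_add of_rat_mult)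

definition V_minus :: "nat \<Rightarrow> nat \<Rightarrow> real set" where
  "V_minus k q = rat_span {hurwitz_zeta_minus k (real a / real q) | a.
     1 \<le> a \<and> real a < real q / 2 \<and> coprime a q}"

end

theory Submission
  imports Defs "HOL-Number_Theory.Cong" "HOL-Real_Asymp.Real_Asymp"
begin

text \<open>
  The idea is a single family of rational functions with simple poles at the points $-j/q$, $|j| \le qn$.
  Differentiating $k - 1$ times makes all poles have order $k$, so that summing over the integers beyond
  $n$ produces linear forms in the numbers $\zeta^-(k, a/q)$ and $1$ whose coefficients at the zeta values
  are integers of size about $4^{qn}$; only the rational constant has a denominator, a divisor of
  $\mathrm{lcm}(1, \ldots, 2qn)^k$. The numerator has zeros of order $k$ at all integers $1 \le |i| \le 2t$
  with $t = rn$, $r$ about $q / (\log q)^2$, except that the order at $\pm t$ is only $k - 1$. Because of this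
  gap exactly one term, the one at $t$, dominates the sum; without the gap the sum of a derivative of a
  bump function would cancel. Hence the forms have size $r^{-2qn (1 + o(1))}$, with matching lower bound.

  In the linear independence criterion the denominator of the constant is paid for once and not
  once per dimension: one approximates the zeta values simultaneously with a common denominator that is a
  multiple of this lcm. So the dimension is at least
  $(2q \log r - O_k(q)) / (2q \log 2 + o(q)) \sim \log q / \log 2$.

  All residue classes modulo $q$ occur as poles, not only those coprime to $q$; the additional values
  $\zeta^-(k, a/q)$ lie in the span because the operators $1 - p^{-k} \sigma_p$ in the distribution
  relations are invertible.
\<close>

section \<open>Divisibility of factorials and the least common multiple of an initial segment\<close>

text \<open>Simple poles keep the coefficients free of denominators: a residue at a simple pole is a
  product of values, here a binomial coefficient \<open>2 * J choose (J + j)\<close> times integers,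
  whereas poles of higher order would bring in derivatives and with them an lcm in every
  coefficient. This binomial coefficient is the only factor of the residues that is exponential in q
  n; its size 4^(q n) is the origin of log 2 in the final constant.

  All other factors are q^(O(t k)) with t = r n. They are negligible once r log q = o(q), while the
  gain 2 q log r must stay asymptotic to 2 q log q. Taking r about q / (log q)^2 meets both demands;
  r = q / log q would already fail the first. This is why the estimates can be crude: factors such
  as 2, t or q t are absorbed into powers of q.

  The upper and lower bounds for the forms agree only up to E^n, where log E = o(q). The criterion
  therefore has two rates \<open>A\<close> and \<open>B\<close>, and their discrepancy merely
  enlarges the quality \<open>x\<close> demanded of the simultaneous approximation.\<close>

lemma prime_dvd_prime_power_choose:
  fixes p :: nat
  assumes "prime p" "0 < i" "i < p ^ e"
  shows "p dvd (p ^ e choose i)"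
proof (rule ccontr)
  assume "\<not> p dvd (p ^ e choose i)"
  then have "coprime (p ^ e) (p ^ e choose i)"
    using assms(1) by (simp add: prime_imp_coprime)
  moreover have "p ^ e dvd i * (p ^ e choose i)"
    using times_binomial_minus1_eq[of i "p ^ e"] assms(2) by simp
  ultimately have "p ^ e dvd i"
    using coprime_dvd_mult_left_iff by blast
  with assms show False by (auto dest: dvd_imp_le)
qed

text \<open>Vandermonde for 2m = p^e + (2m - p^e): the term i = 0 vanishes because 2m - p^e < m, and
  p divides \<open>p ^ e choose i\<close> for 0 < i < p^e.\<close>

lemma prime_dvd_central_binomial:
  fixes p :: nat
  assumes "prime p" "m < p ^ e" "p ^ e \<le> 2 * m"
  shows "p dvd (2 * m choose m)"
proof -
  have "p dvd (p ^ e choose i) * (2 * m - p ^ e choose (m - i))" if "i \<le> m" for i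
  proof (cases "i = 0")
    case True
    then show ?thesis using assms by (simp add: binomial_eq_0)
  next
    case False
    then show ?thesis
      using prime_dvd_prime_power_choose[of p i e] assms that by simp
  qed
  then have "p dvd (\<Sum>i\<le>m. (p ^ e choose i) * (2 * m - p ^ e choose (m - i)))"
    by (intro dvd_sum) auto
  then show ?thesis using assms by (simp add: vandermonde)
qed

text \<open>Passing from m to 2m raises the exponent of a prime in the lcm by at most one, since
  p^(e-1) <= p^e / 2 <= m; the central binomial coefficient supplies the additional factor
  p.\<close>

lemma prime_power_dvd_Lcm_central_binomial:
  fixes p :: nat
  assumes "prime p" "p ^ e \<le> 2 * m"
  shows "p ^ e dvd Lcm {1..m} * (2 * m choose m)"
proof (cases "p ^ e \<le> m")
  case True
  then have "p ^ e \<in> {1..m}" using assms(1) by (simp add: Suc_leI prime_gt_0_nat)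
  then show ?thesis by (intro dvd_mult2 dvd_Lcm)
next
  case False
  show ?thesis
  proof (cases e)
    case 0
    then show ?thesis by simp
  next
    case (Suc e')
    have "2 * p ^ e' \<le> p ^ e"
      using Suc prime_ge_2_nat[OF assms(1)] by simp
    then have "p ^ e' \<in> {1..m}"
      using assms by (auto simp: Suc_leI prime_gt_0_nat)
    then have "p ^ e' dvd Lcm {1..m}" by (rule dvd_Lcm)
    moreover have "p dvd (2 * m choose m)"
      using prime_dvd_central_binomial[of p m e] assms False by simp
    ultimately show ?thesis
      using mult_dvd_mono Suc by (metis power_Suc2)
  qed
qed

lemma Lcm_double_dvd: "Lcm {1..2*m} dvd Lcm {1..m} * (2 * m choose m)"
proof (rule Lcm_least)
  fix j :: nat assume j: "j \<in> {1..2*m}"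
  show "j dvd Lcm {1..m} * (2 * m choose m)"
  proof (rule multiplicity_le_imp_dvd)
    show "j \<noteq> 0" using j by simp
  next
    fix p :: nat assume p: "prime p"
    have "p ^ multiplicity p j dvd j" by (rule multiplicity_dvd)
    then have "p ^ multiplicity p j \<le> 2 * m" using j by (auto dest: dvd_imp_le)
    from prime_power_dvd_Lcm_central_binomial[OF p this]
    show "multiplicity p j \<le> multiplicity p (Lcm {1..m} * (2 * m choose m))"
      using p j by (intro multiplicity_geI) (auto simp: Lcm_0_iff)
  qed
qed

lemma Lcm_atLeastAtMost_pos: "0 < (Lcm {1..m} :: nat)"
  by (rule Nat.gr0I) (auto simp: Lcm_0_iff)

text \<open>Iterated halving costs about 4^(n/2 + n/4 + ...) = 4^n; the base 16 leaves room for
  rounding when n is odd. Any exponential bound serves, as its logarithm only contributes O_k(q)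
  against 2 q log r.\<close>

lemma Lcm_atLeastAtMost_le: "(Lcm {1..n} :: nat) \<le> 16 ^ n"
proof (induction n rule: less_induct)
  case (less n)
  have double: "(Lcm {1..2*m} :: nat) \<le> Lcm {1..m} * 4 ^ m" for m :: nat
  proof -
    have "(Lcm {1..2*m} :: nat) \<le> Lcm {1..m} * (2 * m choose m)"
      using Lcm_double_dvd[of m] Lcm_atLeastAtMost_pos[of m]
      by (intro dvd_imp_le) auto
    also have "(2 * m choose m) \<le> 2 ^ (2 * m)" by (rule binomial_le_pow2)
    finally show ?thesis by (simp add: power_mult)
  qed
  show ?case
  proof (cases "n \<le> 1")
    case True
    then have "n = 0 \<or> n = 1" by auto
    then show ?thesis by auto
  next
    case False
    define m where "m = (n + 1) div 2"
    have m: "n \<le> 2 * m" "2 * m \<le> n + 1" "m < n" using False by (auto simp: m_def)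
    have "(Lcm {1..n} :: nat) dvd Lcm {1..2*m}"
      using m by (intro Lcm_subset) auto
    then have "(Lcm {1..n} :: nat) \<le> Lcm {1..2*m}"
      using Lcm_atLeastAtMost_pos by (intro dvd_imp_le) auto
    also have "\<dots> \<le> 16 ^ m * 4 ^ m"
      using double[of m] less.IH[OF m(3)] by (meson le_trans mult_le_mono1)
    also have "\<dots> = 2 ^ (6 * m)"
      by (simp add: power_mult power_mult_distrib[symmetric])
    also have "\<dots> \<le> 2 ^ (4 * n)"
      using m False by (intro power_increasing) auto
    finally show ?thesis by (simp add: power_mult)
  qed
qed

section \<open>Factorials dividing products over arithmetic progressions\<close>

lemma multiplicity_fact_le:
  fixes p :: nat
  assumes "prime p"
  shows "multiplicity p (fact n :: nat) \<le> n"
proof (induction n rule: less_induct)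
  case (less n)
  show ?case
  proof (cases "n = 0")
    case False
    have p: "2 \<le> p" using assms by (rule prime_ge_2_nat)
    define M where "M = n div p"
    have "2 * M \<le> p * M" using p by simp
    also have "p * M \<le> n" by (simp add: M_def)
    finally have M: "M < n" "2 * M \<le> n" using False by auto
    \<comment> \<open>Legendre's recursion: only multiples of p contribute, so the exponent of p in
      n! is M plus its exponent in M!, and by induction at most 2M.\<close>
    have "multiplicity p (fact n :: nat) = (\<Sum>i\<in>{1..n}. multiplicity p i)"
      unfolding fact_prod of_nat_id
      using assms by (intro prime_elem_multiplicity_prod_distrib) auto
    also have "\<dots> = (\<Sum>i\<in>(\<lambda>j. p * j) ` {1..M}. multiplicity p i)"
    proof (rule sum.mono_neutral_right)
      show "(\<lambda>j. p * j) ` {1..M} \<subseteq> {1..n}"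
        using p by (auto simp: M_def less_eq_div_iff_mult_less_eq mult.commute)
      show "\<forall>i\<in>{1..n} - (\<lambda>j. p * j) ` {1..M}. multiplicity p i = 0"
      proof
        fix i assume i: "i \<in> {1..n} - (\<lambda>j. p * j) ` {1..M}"
        have "\<not> p dvd i"
        proof
          assume "p dvd i"
          then obtain j where "i = p * j" by auto
          with i p show False by (auto simp: M_def less_eq_div_iff_mult_less_eq mult.commute)
        qed
        then show "multiplicity p i = 0" by (rule not_dvd_imp_multiplicity_0)
      qed
    qed auto
    also have "\<dots> = (\<Sum>j\<in>{1..M}. multiplicity p (p * j))"
      using p by (subst sum.reindex) (auto simp: inj_on_def)
    also have "\<dots> = (\<Sum>j\<in>{1..M}. 1 + multiplicity p j)"
      using assms p by (intro sum.cong) (auto simp: multiplicity_times_same)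
    also have "\<dots> = M + multiplicity p (fact M :: nat)"
      unfolding fact_prod of_nat_id sum.distrib
      using assms by (subst prime_elem_multiplicity_prod_distrib) auto
    also have "\<dots> \<le> M + M" using less.IH[OF M(1)] by simp
    finally show ?thesis using M by simp
  qed auto
qed

text \<open>Modulo m! the product depends only on s modulo m!. A nonnegative representative b turns
  it into (m + b)! / b!.\<close>

lemma fact_dvd_prod_consecutive: "int (fact m) dvd (\<Prod>i=1..m. int i + s)"
proof -
  define b where "b = nat (s + int (fact m) * \<bar>s\<bar>)"
  have "\<bar>s\<bar> \<le> int (fact m) * \<bar>s\<bar>"
    using mult_right_mono[of 1 "int (fact m)" "\<bar>s\<bar>"] by simp
  then have b: "int b = s + int (fact m) * \<bar>s\<bar>" by (simp add: b_def)
  have "fact b * (\<Prod>i=1..m. i + b) = (fact (m + b) :: nat)"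
    by (induction m) (simp_all add: algebra_simps)
  moreover have "(fact m * fact b :: nat) dvd fact (m + b)" by (rule fact_fact_dvd_fact)
  ultimately have "fact b * fact m dvd fact b * (\<Prod>i=1..m. i + b)"
    by (simp add: mult.commute)
  then have "fact m dvd (\<Prod>i=1..m. i + b)"
    using dvd_times_left_cancel_iff[of "fact b :: nat"] by simp
  then have "int (fact m) dvd (\<Prod>i=1..m. int i + int b)"
    by (metis (no_types, lifting) int_dvd_int_iff of_nat_add of_nat_prod of_nat_fact prod.cong)
  moreover have "[(\<Prod>i=1..m. int i + int b) = (\<Prod>i=1..m. int i + s)] (mod int (fact m))"
    by (intro cong_prod cong_add cong_refl) (simp add: b cong_iff_dvd_diff)
  ultimately show ?thesis using cong_dvd_iff by blast
qed

text \<open>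
  For $p \nmid q$ the progression is congruent, up to units, to consecutive integers; for $p \mid q$ the
  factor $q^m$ suffices since $p^m$ exceeds the $p$-part of $m!$.
\<close>

lemma fact_dvd_prod_arith_progression:
  fixes q :: nat and s :: int
  assumes "q > 0"
  shows "int (fact m) dvd int q ^ m * (\<Prod>i=1..m. int q * int i + s)"
proof (cases "(\<Prod>i=1..m. int q * int i + s) = 0")
  case False
  show ?thesis
  proof (rule multiplicity_le_imp_dvd)
    fix p :: int assume p: "prime p"
    define p' where "p' = nat p"
    have p': "prime p'" "p = int p'" using p prime_ge_0_int[OF p] by (simp_all add: p'_def)
    define e where "e = multiplicity p (int (fact m))"
    have pe: "p ^ e dvd int (fact m)" unfolding e_def by (rule multiplicity_dvd)
    then have "int (p' ^ e) dvd int (fact m)" by (simp add: p'(2))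
    then have "p' ^ e dvd fact m" by (simp only: int_dvd_int_iff)
    then have "e \<le> multiplicity p' (fact m :: nat)"
      using p'(1) by (intro multiplicity_geI) auto
    then have e: "e \<le> m" using multiplicity_fact_le[OF p'(1), of m] by simp
    have "p ^ e dvd int q ^ m * (\<Prod>i=1..m. int q * int i + s)"
    proof (cases "p dvd int q")
      case True
      have "p ^ e dvd p ^ m"
        using e by (rule le_imp_power_dvd)
      also have "p ^ m dvd int q ^ m" using True by (rule dvd_power_same)
      finally show ?thesis by (rule dvd_mult2)
    next
      case False
      then have "coprime (int q) (p ^ e)"
        using prime_imp_coprime[OF p False] by (simp add: coprime_commute)
      then obtain v where v: "[int q * v = 1] (mod p ^ e)"
        using cong_solve_coprime_int[of "int q" "p ^ e"] by blast
      have "p ^ e dvd (\<Prod>i=1..m. int i + v * s)"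
        by (rule dvd_trans[OF pe fact_dvd_prod_consecutive])
      then have "p ^ e dvd int q ^ m * (\<Prod>i=1..m. int i + v * s)" by simp
      also have "int q ^ m * (\<Prod>i=1..m. int i + v * s) = (\<Prod>i=1..m. int q * int i + (int q * v) * s)"
      proof -
        have "int q ^ m = (\<Prod>i=1..m. int q)" by simp
        then show ?thesis by (simp only: prod.distrib[symmetric] distrib_left mult.assoc)
      qed
      finally have "p ^ e dvd (\<Prod>i=1..m. int q * int i + (int q * v) * s)" .
      moreover have "[(\<Prod>i=1..m. int q * int i + (int q * v) * s) = (\<Prod>i=1..m. int q * int i + 1 * s)] (mod p ^ e)"
        using v by (intro cong_prod cong_add cong_mult cong_refl)
      ultimately show ?thesis using cong_dvd_iff by fastforce
    qed
    then show "multiplicity p (int (fact m)) \<le> multiplicity p (int q ^ m * (\<Prod>i=1..m. int q * int i + s))"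
      using p False assms by (intro multiplicity_geI) (auto simp: e_def)
  qed simp
qed (simp only: mult_zero_right dvd_0_right)

section \<open>Partial fractions and the sum of absolute coefficients of a power series\<close>

text \<open>The expansion of 1 / (b + X). Its coefficient of order k - 1 is 1 / b^k up to sign,
  which is how a simple pole yields terms of a zeta value of weight k.\<close>

definition fps_inverse_linear :: "real \<Rightarrow> real fps" where
  "fps_inverse_linear b = Abs_fps (\<lambda>n. (-1) ^ n / b ^ Suc n)"

lemma fps_inverse_linear_mult:
  assumes "b \<noteq> 0"
  shows "fps_inverse_linear b * (fps_const b + fps_X) = 1"
proof (rule fps_ext)
  fix n
  show "fps_nth (fps_inverse_linear b * (fps_const b + fps_X)) n = fps_nth 1 n"
    using assms by (cases n) (simp_all add: fps_inverse_linear_def distrib_left)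
qed

text \<open>The nodes are the points -j because the poles are written as zeros of X + u. Both sides
  have degree below \<open>card S\<close> and agree at the nodes.\<close>

lemma lagrange_interpolation:
  fixes P :: "real poly" and S :: "int set"
  assumes "finite S" "degree P < card S"
  shows "P = (\<Sum>j\<in>S. smult (poly P (- of_int j) / (\<Prod>u\<in>S-{j}. of_int u - of_int j)) (\<Prod>u\<in>S-{j}. [:of_int u, 1:]))"
    (is "P = ?R")
proof (rule poly_eqI_degree[where A = "(\<lambda>j. - of_int j) ` S"])
  have card: "card ((\<lambda>j. - real_of_int j) ` S) = card S" by (intro card_image) (auto simp: inj_on_def)
  show "degree P < card ((\<lambda>j. - real_of_int j) ` S)" unfolding card by (rule assms)
  have "degree (smult (poly P (- of_int j) / (\<Prod>u\<in>S-{j}. of_int u - of_int j)) (\<Prod>u\<in>S-{j}. [:of_int u, 1:])) \<le> card S - 1"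
    if "j \<in> S" for j
  proof -
    have "degree (\<Prod>u\<in>S-{j}. [:real_of_int u, 1:]) \<le> card (S - {j})"
      by (rule order.trans[OF degree_prod_sum_le]) (use assms in auto)
    then show ?thesis using that assms by (intro order.trans[OF degree_smult_le]) auto
  qed
  then have "degree ?R \<le> card S - 1" using assms by (intro degree_sum_le) auto
  then show "degree ?R < card ((\<lambda>j. - real_of_int j) ` S)" unfolding card using assms by simp
next
  fix x assume "x \<in> (\<lambda>j. - real_of_int j) ` S"
  then obtain l where l: "l \<in> S" "x = - of_int l" by auto
  have "poly ?R x = (\<Sum>j\<in>S. poly P (- of_int j) / (\<Prod>u\<in>S-{j}. of_int u - of_int j) * (\<Prod>u\<in>S-{j}. of_int u - of_int l))"
    by (simp add: poly_sum poly_prod l(2))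
  also have "\<dots> = (\<Sum>j\<in>{l}. poly P (- of_int j) / (\<Prod>u\<in>S-{j}. of_int u - of_int j) * (\<Prod>u\<in>S-{j}. of_int u - of_int l))"
    using assms(1) l(1) by (intro sum.mono_neutral_right) (auto intro!: prod_zero)
  also have "\<dots> = poly P x" using assms(1) by (simp add: l(2))
  finally show "poly P x = poly ?R x" by simp
qed

text \<open>The partial fraction decomposition expanded at T, so that reading off a coefficient
  replaces repeated differentiation. The degree bound excludes a polynomial part.\<close>

lemma fps_partial_fractions:
  fixes P :: "real poly" and S :: "int set" and T :: real
  assumes "finite S" "degree P < card S" and nz: "\<And>u. u \<in> S \<Longrightarrow> T + of_int u \<noteq> 0"
  shows "fps_of_poly (pcompose P [:T, 1:]) * (\<Prod>u\<in>S. fps_inverse_linear (T + of_int u)) =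
    (\<Sum>j\<in>S. fps_const (poly P (- of_int j) / (\<Prod>u\<in>S-{j}. of_int u - of_int j)) * fps_inverse_linear (T + of_int j))"
proof -
  let ?c = "\<lambda>j. poly P (- of_int j) / (\<Prod>u\<in>S-{j}. of_int u - of_int j)"
  let ?X = "\<lambda>u. fps_const (T + of_int u) + fps_X" and ?L = "\<lambda>u. fps_inverse_linear (T + of_int u)"
  have "fps_of_poly (pcompose P [:T, 1:]) = (\<Sum>j\<in>S. fps_const (?c j) * (\<Prod>u\<in>S-{j}. ?X u))"
    by (subst lagrange_interpolation[OF assms(1,2)])
      (simp add: pcompose_sum pcompose_smult pcompose_prod pcompose_pCons fps_of_poly_sum
        fps_of_poly_smult fps_of_poly_prod fps_of_poly_pCons ac_simps)
  then have "fps_of_poly (pcompose P [:T, 1:]) * (\<Prod>u\<in>S. ?L u) =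
      (\<Sum>j\<in>S. fps_const (?c j) * ((\<Prod>u\<in>S-{j}. ?X u) * (\<Prod>u\<in>S. ?L u)))"
    by (simp add: sum_distrib_right mult.assoc)
  also have "\<dots> = (\<Sum>j\<in>S. fps_const (?c j) * ?L j)"
  proof (intro sum.cong refl arg_cong2[where f = "(*)"])
    fix j assume j: "j \<in> S"
    have "(\<Prod>u\<in>S-{j}. ?X u) * (\<Prod>u\<in>S. ?L u) = ?L j * ((\<Prod>u\<in>S-{j}. ?L u) * (\<Prod>u\<in>S-{j}. ?X u))"
      using assms(1) j by (subst prod.remove[of S j ?L]) (auto simp: mult_ac)
    also have "(\<Prod>u\<in>S-{j}. ?L u) * (\<Prod>u\<in>S-{j}. ?X u) = (\<Prod>u\<in>S-{j}. 1)"
      unfolding prod.distrib[symmetric] using nz by (intro prod.cong) (auto simp: fps_inverse_linear_mult)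
    finally show "(\<Prod>u\<in>S-{j}. ?X u) * (\<Prod>u\<in>S. ?L u) = ?L j" by simp
  qed
  finally show ?thesis .
qed

text \<open>
  The submultiplicative bound below replaces Cauchy's estimate on the circle of radius 1.
\<close>

definition fps_l1_bound :: "real fps \<Rightarrow> real \<Rightarrow> bool" where
  "fps_l1_bound F B \<longleftrightarrow> (\<forall>m. (\<Sum>i\<le>m. \<bar>fps_nth F i\<bar>) \<le> B)"

lemma fps_l1_bound_nth: "fps_l1_bound F B \<Longrightarrow> \<bar>fps_nth F i\<bar> \<le> B"
  unfolding fps_l1_bound_def by (rule order.trans[OF member_le_sum[of i "{..i}" "\<lambda>i. \<bar>fps_nth F i\<bar>"]]) auto

lemma fps_l1_bound_nonneg: "fps_l1_bound F B \<Longrightarrow> 0 \<le> B"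
  using fps_l1_bound_nth[of F B 0] by simp

lemma fps_l1_bound_mult:
  assumes "fps_l1_bound F B" "fps_l1_bound G C"
  shows "fps_l1_bound (F * G) (B * C)"
  unfolding fps_l1_bound_def
proof
  fix m
  have "(\<Sum>n\<le>m. \<bar>fps_nth (F * G) n\<bar>) \<le> (\<Sum>n\<le>m. \<Sum>i\<le>n. \<bar>fps_nth F i\<bar> * \<bar>fps_nth G (n - i)\<bar>)"
    unfolding fps_mult_nth atLeast0AtMost abs_mult[symmetric] by (intro sum_mono sum_abs)
  also have "\<dots> = (\<Sum>(i, j)\<in>{(i, j). i + j \<le> m}. \<bar>fps_nth F i\<bar> * \<bar>fps_nth G j\<bar>)"
    by (rule sum.triangle_reindex_eq[symmetric])
  also have "\<dots> \<le> (\<Sum>(i, j)\<in>{..m} \<times> {..m}. \<bar>fps_nth F i\<bar> * \<bar>fps_nth G j\<bar>)"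
    by (intro sum_mono2) auto
  also have "\<dots> = (\<Sum>i\<le>m. \<bar>fps_nth F i\<bar>) * (\<Sum>j\<le>m. \<bar>fps_nth G j\<bar>)"
    by (simp add: sum_product sum.cartesian_product)
  also have "\<dots> \<le> B * C"
    using assms fps_l1_bound_nonneg[OF assms(1)] unfolding fps_l1_bound_def
    by (intro mult_mono) (auto intro: sum_nonneg)
  finally show "(\<Sum>n\<le>m. \<bar>fps_nth (F * G) n\<bar>) \<le> B * C" .
qed

lemma fps_l1_bound_const: "\<bar>c\<bar> \<le> B \<Longrightarrow> fps_l1_bound (fps_const c) B"
proof -
  have "(\<Sum>i\<le>m. \<bar>fps_nth (fps_const c) i\<bar>) = (\<Sum>i\<le>m. if i = 0 then \<bar>c\<bar> else 0)" for m
    by (intro sum.cong) auto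
  then show "\<bar>c\<bar> \<le> B \<Longrightarrow> fps_l1_bound (fps_const c) B" by (simp add: fps_l1_bound_def)
qed

lemma fps_l1_bound_prod:
  assumes "\<And>i. i \<in> S \<Longrightarrow> fps_l1_bound (F i) (B i)"
  shows "fps_l1_bound (\<Prod>i\<in>S. F i) (\<Prod>i\<in>S. B i)"
  using assms
proof (induction S rule: infinite_finite_induct)
  case (insert x S)
  then show ?case by (simp add: fps_l1_bound_mult)
qed (use fps_l1_bound_const[of 1 1] in simp_all)

lemma fps_l1_bound_power: "fps_l1_bound F B \<Longrightarrow> fps_l1_bound (F ^ n) (B ^ n)"
  using fps_l1_bound_prod[of "{..<n}" "\<lambda>_. F" "\<lambda>_. B"] by simp

text \<open>A geometric series. The value 1 / (b - 1) is also the maximum of |1 / (b + z)| on the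
  unit circle, so nothing is lost against Cauchy's estimate.\<close>

lemma fps_l1_bound_inverse_linear:
  assumes "b > 1"
  shows "fps_l1_bound (fps_inverse_linear b) (1 / (b - 1))"
  unfolding fps_l1_bound_def
proof
  fix m
  have "(\<Sum>i\<le>m. \<bar>fps_nth (fps_inverse_linear b) i\<bar>) = (\<Sum>i\<le>m. 1 / b ^ Suc i)"
    using assms by (intro sum.cong) (auto simp: fps_inverse_linear_def abs_mult power_abs)
  also have "\<dots> = (1 - 1 / b ^ Suc m) / (b - 1)"
  proof (induction m)
    case 0
    then show ?case using assms by (simp add: field_simps)
  next
    case (Suc m)
    have "(1 - 1 / b ^ Suc m) / (b - 1) + 1 / (b * b ^ Suc m) = (1 - 1 / (b * b ^ Suc m)) / (b - 1)"
      using assms by (simp add: divide_simps) (simp add: algebra_simps)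
    then show ?case unfolding sum.atMost_Suc Suc by simp
  qed
  also have "\<dots> \<le> 1 / (b - 1)" using assms by (intro divide_right_mono) auto
  finally show "(\<Sum>i\<le>m. \<bar>fps_nth (fps_inverse_linear b) i\<bar>) \<le> 1 / (b - 1)" .
qed

lemma fps_l1_bound_add: "fps_l1_bound F B \<Longrightarrow> fps_l1_bound G C \<Longrightarrow> fps_l1_bound (F + G) (B + C)"
  unfolding fps_l1_bound_def
proof
  fix m assume "\<forall>m. (\<Sum>i\<le>m. \<bar>fps_nth F i\<bar>) \<le> B" "\<forall>m. (\<Sum>i\<le>m. \<bar>fps_nth G i\<bar>) \<le> C"
  then have "(\<Sum>i\<le>m. \<bar>fps_nth F i\<bar>) + (\<Sum>i\<le>m. \<bar>fps_nth G i\<bar>) \<le> B + C" by (intro add_mono) auto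
  then show "(\<Sum>i\<le>m. \<bar>fps_nth (F + G) i\<bar>) \<le> B + C"
    unfolding sum.distrib[symmetric] by (rule order.trans[rotated]) (auto intro!: sum_mono abs_triangle_ineq)
qed

lemma fps_l1_bound_X: "fps_l1_bound fps_X 1"
proof -
  have "(\<Sum>i\<le>m. \<bar>fps_nth fps_X i :: real\<bar>) = (\<Sum>i\<le>m. if i = 1 then 1 else 0)" for m
    by (intro sum.cong) auto
  then show ?thesis by (simp add: fps_l1_bound_def)
qed

lemma fps_X_power_mult_nth_last: "fps_nth (fps_X ^ m * F) m = (fps_nth F 0 :: real)"
  by (simp add: fps_X_power_mult_nth)

section \<open>A linear independence criterion\<close>

text \<open>
  Dirichlet's theorem gives $Q$, a multiple of $\delta_N$, with all $Q \eta_i$ close to integers. For the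
  least $n$ with $Q |\Lambda_n| < 1/2$, replacing $Q \eta_i$ by these integers in $Q \Lambda_n$ gives an
  integer of absolute value less than 1, hence 0, so that $Q |\Lambda_n|$ would be smaller than the
  lower bound for the $\Lambda_n$ allows.
\<close>

lemma linear_forms_criterion:
  fixes \<eta> \<Lambda> \<rho> :: "nat \<Rightarrow> real" and c :: "nat \<Rightarrow> nat \<Rightarrow> int" and \<delta> :: "nat \<Rightarrow> nat"
    and A B C G H x :: real
  assumes form: "\<And>n. n \<ge> 1 \<Longrightarrow> \<Lambda> n = \<rho> n + (\<Sum>i<d. of_int (c n i) * \<eta> i)"
    and int: "\<And>n. n \<ge> 1 \<Longrightarrow> of_nat (\<delta> n) * \<rho> n \<in> \<int>"
    and dvd: "\<And>m n. 1 \<le> m \<Longrightarrow> m \<le> n \<Longrightarrow> \<delta> m dvd \<delta> n"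
    and pos: "\<And>n. n \<ge> 1 \<Longrightarrow> \<delta> n > 0"
    and coeff: "\<And>n i. n \<ge> 1 \<Longrightarrow> i < d \<Longrightarrow> \<bar>of_int (c n i)\<bar> \<le> C * H ^ n"
    and den: "\<And>n. n \<ge> 1 \<Longrightarrow> real (\<delta> n) \<le> C * G ^ n"
    and lower: "\<And>n. n \<ge> 1 \<Longrightarrow> 1 \<le> C * B ^ n * \<bar>\<Lambda> n\<bar>"
    and upper: "\<And>n. n \<ge> 1 \<Longrightarrow> \<bar>\<Lambda> n\<bar> * A ^ n \<le> C"
    and "C \<ge> 1" "H \<ge> 1" "G \<ge> 1" "0 < A" "A \<le> B" "x \<ge> 1"
    and small: "x ^ d * G < A" "H * B < x * A"
  shows False
proof -
  have "(\<lambda>N. C ^ 2 * 2 ^ d * (x ^ d * G / A) ^ N) \<longlonglongrightarrow> C ^ 2 * 2 ^ d * 0"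
    using assms by (intro tendsto_intros LIMSEQ_power_zero) auto
  then have ev1: "eventually (\<lambda>N. C ^ 2 * 2 ^ d * (x ^ d * G / A) ^ N < 1 / 2) sequentially"
    by (rule order_tendstoD) auto
  have "(\<lambda>N. real d * 2 * A * C ^ 3 * (H * B / (x * A)) ^ N) \<longlonglongrightarrow> real d * 2 * A * C ^ 3 * 0"
    using assms by (intro tendsto_intros LIMSEQ_power_zero) auto
  then have ev2: "eventually (\<lambda>N. real d * 2 * A * C ^ 3 * (H * B / (x * A)) ^ N < 1) sequentially"
    by (rule order_tendstoD) auto
  \<comment> \<open>The first inequality will give
    \<open>Q * \<bar>\<Lambda> N\<bar> < 1 / 2\<close>, the second will keep the approximation error
    below \<open>Q * \<bar>\<Lambda> n\<bar>\<close>.\<close>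
  obtain N where N: "N \<ge> 1" "C ^ 2 * 2 ^ d * (x ^ d * G / A) ^ N < 1 / 2"
      "real d * 2 * A * C ^ 3 * (H * B / (x * A)) ^ N < 1"
    using eventually_happens[OF eventually_conj[OF eventually_ge_at_top[of 1] eventually_conj[OF ev1 ev2]]]
    by auto
  have xN: "x ^ N \<ge> 1" using assms by (simp add: one_le_power)
  define w where "w = nat \<lfloor>x ^ N\<rfloor> + 1"
  have w: "x ^ N \<le> real w" "real w \<le> 2 * x ^ N" "w > 0"
    using xN by (auto simp: w_def) linarith+
  obtain u p where u: "0 < u" "u \<le> int (w ^ d)"
      and p: "\<And>i. i < d \<Longrightarrow> \<bar>of_int u * (real (\<delta> N) * \<eta> i) - of_int (p i)\<bar> < 1 / w"
    using Dirichlet_approx_simult[OF w(3), of d "\<lambda>i. real (\<delta> N) * \<eta> i"] by blast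
  define Q where "Q = real_of_int u * real (\<delta> N)"
  have u': "real_of_int u \<le> (2 * x ^ N) ^ d"
  proof -
    have "real_of_int u \<le> real w ^ d"
      using u(2) by (metis of_int_le_iff of_int_of_nat_eq of_nat_power)
    also have "\<dots> \<le> (2 * x ^ N) ^ d" using w by (intro power_mono) auto
    finally show ?thesis .
  qed
  have Q1: "Q \<ge> 1"
  proof -
    have "1 * 1 \<le> real_of_int u * real (\<delta> N)"
      using u(1) pos[OF N(1)] by (intro mult_mono) auto
    then show ?thesis by (simp add: Q_def)
  qed
  have "Q * \<bar>\<Lambda> N\<bar> \<le> ((2 * x ^ N) ^ d * (C * G ^ N)) * (C / A ^ N)"
    unfolding Q_def using u' den[OF N(1)] upper[OF N(1)] assms xN
    by (intro mult_mono) (auto simp: field_simps)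
  also have "\<dots> = C ^ 2 * 2 ^ d * (x ^ d * G / A) ^ N"
    by (simp add: power_mult_distrib power_divide power2_eq_square mult_ac flip: power_mult)
  also have "\<dots> < 1 / 2" by (rule N(2))
  finally have QN: "Q * \<bar>\<Lambda> N\<bar> < 1 / 2" .
  define n where "n = (LEAST n. n \<ge> 1 \<and> Q * \<bar>\<Lambda> n\<bar> < 1 / 2)"
  have n: "n \<ge> 1" "Q * \<bar>\<Lambda> n\<bar> < 1 / 2" "n \<le> N"
    using LeastI[of "\<lambda>n. n \<ge> 1 \<and> Q * \<bar>\<Lambda> n\<bar> < 1 / 2" N] N(1) QN
      Least_le[of "\<lambda>n. n \<ge> 1 \<and> Q * \<bar>\<Lambda> n\<bar> < 1 / 2" N] unfolding n_def by auto
  \<comment> \<open>By minimality of n the form with index n - 1 is still at least 1 / (2 Q), which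
    bounds A^(n-1) by a multiple of Q. For n = 1 there is no predecessor, but then
    \<open>Q \<ge> 1\<close> is enough.\<close>
  have AQ: "A ^ n \<le> 2 * C * A * Q"
  proof (cases "n = 1")
    case True
    have "A * 1 \<le> A * (2 * C * Q)"
      using mult_mono[of 1 "2 * C" 1 Q] Q1 assms by (intro mult_left_mono) auto
    then show ?thesis using True by (simp add: mult_ac)
  next
    case False
    define m where "m = n - 1"
    have m: "m \<ge> 1" "n = Suc m" "m < n" using False n by (auto simp: m_def)
    have "\<not> (m \<ge> 1 \<and> Q * \<bar>\<Lambda> m\<bar> < 1 / 2)"
      using not_less_Least m(3) unfolding n_def by blast
    then have "1 / 2 \<le> Q * \<bar>\<Lambda> m\<bar>" using m by auto
    then have "1 / 2 * A ^ m \<le> Q * \<bar>\<Lambda> m\<bar> * A ^ m"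
      using assms by (intro mult_right_mono) auto
    also have "\<dots> \<le> Q * C"
      using upper[OF m(1)] Q1 by (simp add: mult.assoc mult_left_mono)
    finally have "A ^ m \<le> 2 * C * Q" by (simp add: mult_ac)
    then have "A * A ^ m \<le> A * (2 * C * Q)" using \<open>0 < A\<close> by (intro mult_left_mono) auto
    then show ?thesis using m by (simp add: mult_ac)
  qed
  \<comment> \<open>Since A <= B, the uncontrolled index n can be replaced by N in the lower bound
    for the form.\<close>
  have low: "(A / B) ^ N \<le> 2 * C\<^sup>2 * A * (Q * \<bar>\<Lambda> n\<bar>)"
  proof -
    have "(A / B) ^ N \<le> (A / B) ^ n"
      using assms n by (intro power_decreasing) auto
    also have "\<dots> \<le> (2 * C * A * Q) / B ^ n"
      using AQ assms by (simp add: power_divide divide_right_mono)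
    also have "\<dots> \<le> (2 * C * A * Q) * (C * \<bar>\<Lambda> n\<bar>)"
    proof -
      have "1 / B ^ n \<le> C * \<bar>\<Lambda> n\<bar>"
        using lower[OF n(1)] assms by (simp add: field_simps)
      then have "(2 * C * A * Q) * (1 / B ^ n) \<le> (2 * C * A * Q) * (C * \<bar>\<Lambda> n\<bar>)"
        using assms Q1 by (intro mult_left_mono) auto
      then show ?thesis by simp
    qed
    finally show ?thesis by (simp add: power2_eq_square mult_ac)
  qed
  define I where "I = Q * \<rho> n + (\<Sum>i<d. of_int (c n i) * of_int (p i))"
  have "I \<in> \<int>"
  proof -
    obtain r where "\<delta> N = \<delta> n * r" using dvd[OF n(1) n(3)] by auto
    then have "Q * \<rho> n = of_int u * of_nat r * (of_nat (\<delta> n) * \<rho> n)" by (simp add: Q_def)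
    also have "\<dots> \<in> \<int>" by (rule Ints_mult[OF _ int[OF n(1)]]) (rule Ints_mult, auto)
    finally show ?thesis unfolding I_def by (rule Ints_add) (intro Ints_sum Ints_mult Ints_of_int)
  qed
  have "Q * \<Lambda> n - I = (\<Sum>i<d. of_int (c n i) * (Q * \<eta> i - of_int (p i)))"
    unfolding I_def form[OF n(1)] by (simp add: algebra_simps sum_subtractf sum_distrib_left)
  also have "\<bar>\<dots>\<bar> \<le> (\<Sum>i<d. C * H ^ N * (1 / x ^ N))"
  proof (rule order.trans[OF sum_abs], rule sum_mono)
    fix i assume i: "i \<in> {..<d}"
    have "\<bar>of_int (c n i)\<bar> \<le> C * H ^ n" using coeff[OF n(1)] i by simp
    also have "\<dots> \<le> C * H ^ N" using n assms by (intro mult_left_mono power_increasing) auto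
    finally have 1: "\<bar>of_int (c n i)\<bar> \<le> C * H ^ N" .
    have "\<bar>Q * \<eta> i - of_int (p i)\<bar> \<le> 1 / w"
      using p[of i] i by (simp add: Q_def mult.assoc)
    also have "\<dots> \<le> 1 / x ^ N" using w xN by (intro divide_left_mono) auto
    finally show "\<bar>of_int (c n i) * (Q * \<eta> i - of_int (p i))\<bar> \<le> C * H ^ N * (1 / x ^ N)"
      unfolding abs_mult using 1 assms by (intro mult_mono) auto
  qed
  also have "\<dots> = real d * C * (H / x) ^ N" by (simp add: power_divide)
  finally have err: "\<bar>Q * \<Lambda> n - I\<bar> \<le> real d * C * (H / x) ^ N" .
  have "2 * C\<^sup>2 * A * (real d * C * (H / x) ^ N) =
      (real d * 2 * A * C ^ 3 * (H * B / (x * A)) ^ N) * (A / B) ^ N"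
    using assms by (simp add: power_mult_distrib power_divide power2_eq_square power3_eq_cube)
  also have "\<dots> < 1 * (A / B) ^ N"
    using N(3) assms by (intro mult_strict_right_mono zero_less_power) auto
  also have "\<dots> \<le> 2 * C\<^sup>2 * A * (Q * \<bar>\<Lambda> n\<bar>)" using low by simp
  finally have "real d * C * (H / x) ^ N < Q * \<bar>\<Lambda> n\<bar>"
    using assms by (subst (asm) mult_less_cancel_left_pos) auto
  then have *: "\<bar>Q * \<Lambda> n - I\<bar> < \<bar>Q * \<Lambda> n\<bar>" using err Q1 by (simp add: abs_mult)
  moreover have "\<bar>Q * \<Lambda> n\<bar> < 1 / 2" using n(2) Q1 by (simp add: abs_mult)
  ultimately have "\<bar>I\<bar> < 1" by linarith
  with \<open>I \<in> \<int>\<close> have "I = 0" by (simp add: Ints_nonzero_abs_less1)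
  with * show False by simp
qed

lemma common_denominator:
  fixes r :: "'a \<Rightarrow> rat"
  assumes "finite S"
  obtains M :: nat where "M > 0" "\<And>s. s \<in> S \<Longrightarrow> of_nat M * r s \<in> \<int>"
proof -
  have "\<exists>M::nat>0. \<forall>s\<in>S. of_nat M * r s \<in> \<int>"
    using assms
  proof (induction S)
    case empty
    show ?case by (intro exI[of _ 1]) auto
  next
    case (insert s S)
    then obtain M :: nat where M: "M > 0" "\<forall>s\<in>S. of_nat M * r s \<in> \<int>" by blast
    obtain a b where ab: "quotient_of (r s) = (a, b)" by (cases "quotient_of (r s)")
    have b: "b > 0" "r s = of_int a / of_int b"
      using quotient_of_denom_pos[OF ab] quotient_of_div[OF ab] by auto
    have "of_nat (M * nat b) * r t \<in> \<int>" if "t \<in> insert s S" for t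
    proof (cases "t = s")
      case True
      have "of_nat (nat b) * r t = of_int a" using b True by simp
      then have "of_nat (M * nat b) * r t = of_nat M * of_int a" by (simp add: mult.assoc)
      then show ?thesis by (metis Ints_mult Ints_of_int Ints_of_nat)
    next
      case False
      have "of_nat (M * nat b) * r t = of_nat (nat b) * (of_nat M * r t)" by simp
      also have "\<dots> \<in> \<int>" using M False that by (auto intro: Ints_mult[OF Ints_of_nat])
      finally show ?thesis .
    qed
    then show ?case using M(1) b(1) by (intro exI[of _ "M * nat b"]) auto
  qed
  then show ?thesis using that by blast
qed

text \<open>The numbers \<xi> may be linearly dependent. Rewriting the forms in a basis and clearing
  the finitely many denominators of the coordinates by a fixed M affects only the constant C. The
  rational part \<rho> stays outside the basis, so the exponent is the dimension of the span itself,
  whether or not it contains 1.\<close>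

lemma linear_forms_dim_criterion:
  fixes \<xi> :: "'i \<Rightarrow> real" and \<Lambda> \<rho> :: "nat \<Rightarrow> real" and c :: "nat \<Rightarrow> 'i \<Rightarrow> int" and \<delta> :: "nat \<Rightarrow> nat"
    and A B C G H x :: real
  assumes "finite X" "finite I" and \<xi>: "\<And>i. i \<in> I \<Longrightarrow> \<xi> i \<in> rat_span X"
    and form: "\<And>n. n \<ge> 1 \<Longrightarrow> \<Lambda> n = \<rho> n + (\<Sum>i\<in>I. of_int (c n i) * \<xi> i)"
    and int: "\<And>n. n \<ge> 1 \<Longrightarrow> of_nat (\<delta> n) * \<rho> n \<in> \<int>"
    and dvd: "\<And>m n. 1 \<le> m \<Longrightarrow> m \<le> n \<Longrightarrow> \<delta> m dvd \<delta> n"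
    and pos: "\<And>n. n \<ge> 1 \<Longrightarrow> \<delta> n > 0"
    and coeff: "\<And>n i. n \<ge> 1 \<Longrightarrow> i \<in> I \<Longrightarrow> \<bar>of_int (c n i)\<bar> \<le> C * H ^ n"
    and den: "\<And>n. n \<ge> 1 \<Longrightarrow> real (\<delta> n) \<le> C * G ^ n"
    and lower: "\<And>n. n \<ge> 1 \<Longrightarrow> 1 \<le> C * B ^ n * \<bar>\<Lambda> n\<bar>"
    and upper: "\<And>n. n \<ge> 1 \<Longrightarrow> \<bar>\<Lambda> n\<bar> * A ^ n \<le> C"
    and "C \<ge> 1" "H \<ge> 1" "G \<ge> 1" "0 < A" "A \<le> B" "x \<ge> 1"
    and small: "x ^ rat_dim (rat_span X) * G < A" "H * B < x * A"
  shows False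
proof -
  obtain Y where Y: "Y \<subseteq> rat_span X" "real_over_rat.independent Y" "rat_span X \<subseteq> rat_span Y"
      "card Y = rat_dim (rat_span X)"
    by (rule real_over_rat.basis_exists)
  have finY: "finite Y"
    using real_over_rat.independent_span_bound[OF assms(1) Y(2,1)] by simp
  define d where "d = rat_dim (rat_span X)"
  obtain \<eta> where \<eta>: "bij_betw \<eta> {..<d} Y"
    using ex_bij_betw_nat_finite[OF finY] Y(4) by (auto simp: d_def atLeast0LessThan)
  have "\<exists>r. \<xi> i = (\<Sum>y\<in>Y. of_rat (r y) * y)" if "i \<in> I" for i
    using \<xi>[OF that] Y(3) real_over_rat.span_finite[OF finY] by auto
  then obtain r where r: "\<And>i. i \<in> I \<Longrightarrow> \<xi> i = (\<Sum>y\<in>Y. of_rat (r i y) * y)" by metis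
  obtain M :: nat where M: "M > 0" "\<And>s. s \<in> I \<times> Y \<Longrightarrow> of_nat M * (\<lambda>(i, y). r i y) s \<in> \<int>"
    using common_denominator[of "I \<times> Y" "\<lambda>(i, y). r i y"] finY assms(2) by auto
  have "\<exists>z. of_nat M * r i y = of_int z" if "i \<in> I" "y \<in> Y" for i y
    using M(2)[of "(i, y)"] that by (auto elim: Ints_cases)
  then obtain z :: "'i \<Rightarrow> real \<Rightarrow> int" where z: "\<And>i y. i \<in> I \<Longrightarrow> y \<in> Y \<Longrightarrow> of_nat M * r i y = of_int (z i y)"
    by metis
  have zr: "real M * of_rat (r i y) = of_int (z i y)" if "i \<in> I" "y \<in> Y" for i y
    using arg_cong[OF z[OF that], of "of_rat :: rat \<Rightarrow> real"] by (simp add: of_rat_mult)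
  have M\<xi>: "real M * \<xi> i = (\<Sum>j<d. of_int (z i (\<eta> j)) * \<eta> j)" if "i \<in> I" for i
  proof -
    have "real M * \<xi> i = (\<Sum>y\<in>Y. of_int (z i y) * y)"
      unfolding r[OF that] sum_distrib_left
      using zr[OF that] by (intro sum.cong) (auto simp flip: mult.assoc)
    also have "\<dots> = (\<Sum>j<d. of_int (z i (\<eta> j)) * \<eta> j)"
      by (rule sum.reindex_bij_betw[OF \<eta>, symmetric])
    finally show ?thesis .
  qed
  define S where "S = (\<Sum>i\<in>I. \<Sum>j<d. \<bar>real_of_int (z i (\<eta> j))\<bar>)"
  have S: "(\<Sum>i\<in>I. \<bar>real_of_int (z i (\<eta> j))\<bar>) \<le> S" if "j < d" for j
    unfolding S_def using that by (intro sum_mono member_le_sum) auto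
  have S0: "S \<ge> 0" unfolding S_def by (intro sum_nonneg) auto
  define C' where "C' = C * (real M + S)"
  have C': "C * real M \<le> C'" "C * S \<le> C'" "C \<le> C'" "C' \<ge> 1"
  proof -
    show "C * real M \<le> C'" "C * S \<le> C'" unfolding C'_def using assms S0 by (intro mult_left_mono; simp)+
    have "C * 1 \<le> C'" unfolding C'_def using assms S0 M(1) by (intro mult_left_mono) auto
    then show "C \<le> C'" "C' \<ge> 1" using assms by auto
  qed
  show False
  proof (rule linear_forms_criterion[where \<Lambda> = "\<lambda>n. real M * \<Lambda> n" and \<rho> = "\<lambda>n. real M * \<rho> n" and \<eta> = \<eta>
        and c = "\<lambda>n j. \<Sum>i\<in>I. c n i * z i (\<eta> j)" and C = C' and d = d])
    fix n :: nat assume n: "n \<ge> 1"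
    have "real M * (\<Sum>i\<in>I. of_int (c n i) * \<xi> i) = (\<Sum>i\<in>I. of_int (c n i) * (real M * \<xi> i))"
      by (simp add: sum_distrib_left mult_ac)
    also have "\<dots> = (\<Sum>i\<in>I. \<Sum>j<d. of_int (c n i) * of_int (z i (\<eta> j)) * \<eta> j)"
      by (intro sum.cong) (auto simp: M\<xi> sum_distrib_left mult_ac)
    also have "\<dots> = (\<Sum>j<d. \<Sum>i\<in>I. of_int (c n i) * of_int (z i (\<eta> j)) * \<eta> j)"
      by (rule sum.swap)
    finally show "real M * \<Lambda> n = real M * \<rho> n + (\<Sum>j<d. of_int (\<Sum>i\<in>I. c n i * z i (\<eta> j)) * \<eta> j)"
      by (simp add: form[OF n] distrib_left sum_distrib_right)
    have "of_nat (\<delta> n) * (real M * \<rho> n) = of_nat M * (of_nat (\<delta> n) * \<rho> n)" by simp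
    also have "\<dots> \<in> \<int>" by (intro Ints_mult[OF Ints_of_nat] int n)
    finally show "of_nat (\<delta> n) * (real M * \<rho> n) \<in> \<int>" .
    show "real (\<delta> n) \<le> C' * G ^ n"
      using order.trans[OF den[OF n] mult_right_mono[OF C'(3), of "G ^ n"]] \<open>G \<ge> 1\<close> by simp
    have "C * B ^ n * \<bar>\<Lambda> n\<bar> \<le> C' * B ^ n * (real M * \<bar>\<Lambda> n\<bar>)"
      using C' assms M(1) mult_right_mono[of 1 "real M" "\<bar>\<Lambda> n\<bar>"]
      by (intro mult_mono mult_right_mono) auto
    then show "1 \<le> C' * B ^ n * \<bar>real M * \<Lambda> n\<bar>" using lower[OF n] by (simp add: abs_mult)
    have "\<bar>real M * \<Lambda> n\<bar> * A ^ n = real M * (\<bar>\<Lambda> n\<bar> * A ^ n)" by (simp add: abs_mult)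
    also have "\<dots> \<le> real M * C" using upper[OF n] by (intro mult_left_mono) auto
    finally show "\<bar>real M * \<Lambda> n\<bar> * A ^ n \<le> C'" using C' by (simp add: mult.commute)
    fix j assume j: "j < d"
    have "\<bar>real_of_int (\<Sum>i\<in>I. c n i * z i (\<eta> j))\<bar> \<le> (\<Sum>i\<in>I. C * H ^ n * \<bar>real_of_int (z i (\<eta> j))\<bar>)"
      unfolding of_int_sum of_int_mult
      by (rule order.trans[OF sum_abs], rule sum_mono) (auto simp: abs_mult intro!: mult_right_mono coeff n)
    also have "\<dots> \<le> C * H ^ n * S"
      unfolding sum_distrib_left[symmetric] using S[OF j] assms by (intro mult_left_mono) auto
    also have "\<dots> \<le> C' * H ^ n"
      using mult_right_mono[OF C'(2), of "H ^ n"] assms by (simp add: mult_ac)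
    finally show "\<bar>real_of_int (\<Sum>i\<in>I. c n i * z i (\<eta> j))\<bar> \<le> C' * H ^ n" .
  qed (use assms C' d_def in auto)
qed

section \<open>Distribution relations\<close>

text \<open>
  Up to the parity convention this is the sum of $\mathrm{sgn}(m) m^{-k}$ over nonzero $m \in A$; the
  term $m = 0$ vanishes because of $x / 0 = 0$.
\<close>

definition signed_sum :: "nat \<Rightarrow> int set \<Rightarrow> real" where
  "signed_sum k A = (\<Sum>m. (of_bool (int m \<in> A) - (-1) ^ k * of_bool (- int m \<in> A)) / real m ^ k)"

lemma summable_signed_sum:
  fixes a b :: real
  assumes "k \<ge> 2"
  shows "summable (\<lambda>m. (a * of_bool (P m) + b * of_bool (Q m)) / real m ^ k)"
proof (rule summable_comparison_test)
  show "summable (\<lambda>m. (\<bar>a\<bar> + \<bar>b\<bar>) * inverse (real m ^ k))"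
    using assms by (intro summable_mult inverse_power_summable)
  have "\<bar>a * of_bool (P m) + b * of_bool (Q m)\<bar> \<le> \<bar>a\<bar> + \<bar>b\<bar>" for m by auto
  then show "\<exists>N. \<forall>m\<ge>N. norm ((a * of_bool (P m) + b * of_bool (Q m)) / real m ^ k)
      \<le> (\<bar>a\<bar> + \<bar>b\<bar>) * inverse (real m ^ k)"
    by (auto simp: abs_mult divide_inverse intro!: mult_right_mono)
qed

lemma signed_sum_sums:
  assumes "k \<ge> 2"
  shows "(\<lambda>m. (of_bool (int m \<in> A) - (-1) ^ k * of_bool (- int m \<in> A)) / real m ^ k) sums signed_sum k A"
  using summable_signed_sum[OF assms, of 1 "\<lambda>m. int m \<in> A" "- ((-1) ^ k)" "\<lambda>m. - int m \<in> A"]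
  unfolding signed_sum_def by (simp add: summable_sums)

text \<open>The additive form of a distribution relation: the multiples of p in A, written p m,
  carry the factor p^(-k).\<close>

lemma signed_sum_split:
  assumes "k \<ge> 2" "p > 0"
  shows "signed_sum k A = signed_sum k {m \<in> A. \<not> int p dvd m} + signed_sum k {m. int p * m \<in> A} / real p ^ k"
proof -
  define g where "g A m = (of_bool (int m \<in> A) - (-1) ^ k * of_bool (- int m \<in> A)) / real m ^ k" for A m
  have g: "g A sums signed_sum k A" for A
    using signed_sum_sums[OF assms(1)] unfolding g_def .
  have "(\<lambda>m. g {m. int p * m \<in> A} m / real p ^ k) sums (signed_sum k {m. int p * m \<in> A} / real p ^ k)"
    by (intro sums_divide g)
  also have "(\<lambda>m. g {m. int p * m \<in> A} m / real p ^ k) = (\<lambda>m. of_bool (p dvd p * m) * g A (p * m))"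
    by (auto simp: g_def power_mult_distrib)
  also have "\<dots> sums (signed_sum k {m. int p * m \<in> A} / real p ^ k) \<longleftrightarrow>
      (\<lambda>m. of_bool (p dvd m) * g A m) sums (signed_sum k {m. int p * m \<in> A} / real p ^ k)"
    using assms by (intro sums_mono_reindex[of "\<lambda>m. p * m"]) (auto simp: strict_mono_def)
  finally have "(\<lambda>m. g {m \<in> A. \<not> int p dvd m} m + of_bool (p dvd m) * g A m) sums
      (signed_sum k {m \<in> A. \<not> int p dvd m} + signed_sum k {m. int p * m \<in> A} / real p ^ k)"
    by (intro sums_add g)
  also have "(\<lambda>m. g {m \<in> A. \<not> int p dvd m} m + of_bool (p dvd m) * g A m) = g A"
    by (auto simp: g_def)
  finally show ?thesis using g sums_unique2 by blast
qed

lemma signed_sum_Union: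
  assumes "k \<ge> 2" "finite R" "\<And>a b. a \<in> R \<Longrightarrow> b \<in> R \<Longrightarrow> a \<noteq> b \<Longrightarrow> B a \<inter> B b = {}"
  shows "signed_sum k (\<Union>a\<in>R. B a) = (\<Sum>a\<in>R. signed_sum k (B a))"
proof -
  have ind: "of_bool (m \<in> (\<Union>a\<in>R. B a)) = (\<Sum>a\<in>R. of_bool (m \<in> B a) :: real)" for m
  proof (cases "m \<in> (\<Union>a\<in>R. B a)")
    case True
    then obtain a where a: "a \<in> R" "m \<in> B a" by auto
    have "(\<Sum>b\<in>R. of_bool (m \<in> B b) :: real) = (\<Sum>b\<in>R. if b = a then 1 else 0)"
      using assms(3) a by (intro sum.cong) (auto simp: of_bool_def)
    then show ?thesis using a assms(2) by auto
  qed (auto intro!: sum.neutral[symmetric])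
  have "(\<lambda>m. \<Sum>a\<in>R. (of_bool (int m \<in> B a) - (-1) ^ k * of_bool (- int m \<in> B a)) / real m ^ k)
     sums (\<Sum>a\<in>R. signed_sum k (B a))"
    by (intro sums_sum signed_sum_sums assms)
  also have "(\<lambda>m. \<Sum>a\<in>R. (of_bool (int m \<in> B a) - (-1) ^ k * of_bool (- int m \<in> B a)) / real m ^ k) =
     (\<lambda>m. (of_bool (int m \<in> (\<Union>a\<in>R. B a)) - (-1) ^ k * of_bool (- int m \<in> (\<Union>a\<in>R. B a))) / real m ^ k)"
    unfolding ind by (simp only: sum_divide_distrib[symmetric] sum_subtractf sum_distrib_left)
  finally show ?thesis using signed_sum_sums[OF assms(1)] sums_unique2 by blast
qed

section \<open>Hurwitz zeta values as signed sums over residue classes\<close>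

lemma hurwitz_zeta_sums:
  assumes "k \<ge> 2" "x > 0"
  shows "(\<lambda>m. 1 / (real m + x) ^ k) sums hurwitz_zeta (real k) x"
proof -
  have "summable (\<lambda>m. 1 / (real m + x) powr real k)"
    using assms by (intro summable_hurwitz_zeta) auto
  then have "summable (\<lambda>m. 1 / (real m + x) ^ k)"
    using assms by (simp add: powr_realpow add_nonneg_pos)
  then show ?thesis using assms by (simp add: hurwitz_zeta_of_nat summable_sums)
qed

lemma hurwitz_zeta_sums_residue_class:
  assumes "k \<ge> 2" "1 \<le> a" "a < q"
  shows "(\<lambda>m. of_bool ([int m = int a] (mod int q)) / real m ^ k) sums (hurwitz_zeta (real k) (real a / real q) / real q ^ k)"
proof -
  have q: "q > 0" using assms by simp
  have "(\<lambda>m. (1 / (real m + real a / real q) ^ k) / real q ^ k) sums (hurwitz_zeta (real k) (real a / real q) / real q ^ k)"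
    using assms by (intro sums_divide hurwitz_zeta_sums) auto
  also have "(\<lambda>m. (1 / (real m + real a / real q) ^ k) / real q ^ k) =
     (\<lambda>m. of_bool ([int (a + q * m) = int a] (mod int q)) / real (a + q * m) ^ k)"
  proof
    fix m
    have "(real m + real a / real q) * real q = real (a + q * m)"
      using q by (simp add: field_simps)
    moreover have "[int (a + q * m) = int a] (mod int q)" by (simp add: cong_def)
    ultimately show "(1 / (real m + real a / real q) ^ k) / real q ^ k = of_bool ([int (a + q * m) = int a] (mod int q)) / real (a + q * m) ^ k"
      by (simp flip: power_mult_distrib)
  qed
  also have "\<dots> sums (hurwitz_zeta (real k) (real a / real q) / real q ^ k) \<longleftrightarrow> ?thesis"
  proof (rule sums_mono_reindex)
    show "strict_mono (\<lambda>m. a + q * m)" using q by (auto simp: strict_mono_def)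
    fix n assume n: "n \<notin> range (\<lambda>m. a + q * m)"
    have "\<not> [int n = int a] (mod int q)"
    proof
      assume "[int n = int a] (mod int q)"
      then have "n mod q = a" using assms by (metis cong_int_iff cong_def mod_less)
      then have "n = a + q * (n div q)" by (metis mod_mult_div_eq)
      with n show False by blast
    qed
    then show "of_bool ([int n = int a] (mod int q)) / real n ^ k = 0" by simp
  qed
  finally show ?thesis .
qed

lemma signed_sum_residue_class:
  assumes "k \<ge> 2" "1 \<le> a" "a < q"
  shows "signed_sum k {m. [m = int a] (mod int q)} = hurwitz_zeta_minus k (real a / real q) / real q ^ k"
proof -
  have "(\<lambda>m. of_bool ([int m = int a] (mod int q)) / real m ^ k - (-1) ^ k * (of_bool ([int m = int (q - a)] (mod int q)) / real m ^ k)) sums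
     (hurwitz_zeta (real k) (real a / real q) / real q ^ k - (-1) ^ k * (hurwitz_zeta (real k) (real (q - a) / real q) / real q ^ k))"
    using assms by (intro sums_diff sums_mult hurwitz_zeta_sums_residue_class) auto
  also have "(\<lambda>m. of_bool ([int m = int a] (mod int q)) / real m ^ k - (-1) ^ k * (of_bool ([int m = int (q - a)] (mod int q)) / real m ^ k)) =
      (\<lambda>m. (of_bool (int m \<in> {m. [m = int a] (mod int q)}) - (-1) ^ k * of_bool (- int m \<in> {m. [m = int a] (mod int q)})) / real m ^ k)"
  proof -
    have "[int m = int (q - a)] (mod int q) \<longleftrightarrow> [- int m = int a] (mod int q)" for m
    proof -
      have "[int m = int (q - a)] (mod int q) \<longleftrightarrow> int q dvd (int m + int a) - int q"
        using assms by (simp add: cong_iff_dvd_diff of_nat_diff algebra_simps)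
      also have "\<dots> \<longleftrightarrow> int q dvd - (- int m - int a)"
        by (subst dvd_diff_left_iff) (auto simp: algebra_simps)
      finally show ?thesis by (simp only: cong_iff_dvd_diff dvd_minus_iff)
    qed
    then show ?thesis by (auto simp: diff_divide_distrib)
  qed
  also have "hurwitz_zeta (real k) (real a / real q) / real q ^ k - (-1) ^ k * (hurwitz_zeta (real k) (real (q - a) / real q) / real q ^ k)
     = hurwitz_zeta_minus k (real a / real q) / real q ^ k"
    using assms by (simp add: hurwitz_zeta_minus_def of_nat_diff diff_divide_distrib)
  finally show ?thesis using signed_sum_sums[OF assms(1)] sums_unique2 by blast
qed

lemma hurwitz_zeta_minus_reflect:
  "hurwitz_zeta_minus k (1 - x) = - ((-1) ^ k) * hurwitz_zeta_minus k x"
proof -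
  have "(-1) ^ k * (-1) ^ k = (1 :: real)" by (simp flip: power_add)
  then show ?thesis
    unfolding hurwitz_zeta_minus_def diff_diff_eq2 by (simp add: right_diff_distrib flip: mult.assoc)
qed

text \<open>Reflection a -> q - a carries the residues above q/2 to generators, up to sign; a = q/2
  is not coprime to q since q >= 3.\<close>

lemma hurwitz_zeta_minus_in_V_minus_coprime:
  assumes "1 \<le> a" "a < q" "coprime a q" "q \<ge> 3"
  shows "hurwitz_zeta_minus k (real a / real q) \<in> V_minus k q"
proof (cases "real a < real q / 2")
  case True
  then show ?thesis unfolding V_minus_def using assms by (intro real_over_rat.span_base) auto
next
  case False
  define b where "b = q - a"
  have "real b \<noteq> real q / 2"
  proof
    assume "real b = real q / 2"
    then have "q = 2 * a" using assms by (simp add: b_def of_nat_diff field_simps)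
    then show False using assms by auto
  qed
  then have b: "1 \<le> b" "real b < real q / 2" using False assms by (auto simp: b_def of_nat_diff field_simps)
  have "coprime b q"
    using assms by (metis b_def coprime_commute coprime_diff_one_left_nat gcd_diff2_nat coprime_iff_gcd_eq_1 less_imp_le_nat)
  then have "hurwitz_zeta_minus k (real b / real q) \<in> V_minus k q"
    unfolding V_minus_def using b by (intro real_over_rat.span_base) auto
  then have "of_rat (- ((-1) ^ k)) * hurwitz_zeta_minus k (real b / real q) \<in> V_minus k q"
    unfolding V_minus_def by (rule real_over_rat.span_scale)
  moreover have "real a / real q = 1 - real b / real q"
    using assms by (simp add: b_def of_nat_diff field_simps)
  ultimately show ?thesis
    by (simp add: hurwitz_zeta_minus_reflect of_rat_minus of_rat_power)
qed

lemma V_minus_scale: "x \<in> V_minus k q \<Longrightarrow> r \<in> \<rat> \<Longrightarrow> r * x \<in> V_minus k q"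
  unfolding V_minus_def by (erule Rats_cases) (simp add: real_over_rat.span_scale)

text \<open>
  Removing a prime $p$ from the coprimality condition: with $T A = \{m \mid p m \in A\}$ the sum over $A$ is,
  modulo the span, $p^{-ki}$ times the sum over $T^i A$, and the sets $T^i A$ repeat since $A$ is periodic.
\<close>

lemma signed_sum_in_V_minus:
  assumes k: "k \<ge> 2" and q: "q \<ge> 3" and D: "D \<subseteq> prime_factors q"
    and A: "\<And>m j. m \<in> A \<longleftrightarrow> m + j * int q \<in> A"
    and cop: "\<And>m p. m \<in> A \<Longrightarrow> p \<in> prime_factors q - D \<Longrightarrow> \<not> int p dvd m"
  shows "signed_sum k A \<in> V_minus k q"
proof -
  have "finite D" using D finite_subset by blast
  then show ?thesis using D A cop
  proof (induction D arbitrary: A rule: finite_induct)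
    case (empty A)
    \<comment> \<open>Here A contains only integers coprime to q, so it is a finite union of coprime
      residue classes.\<close>
    define R where "R = {a. a < q \<and> int a \<in> A}"
    have mem: "m \<in> A \<longleftrightarrow> nat (m mod int q) \<in> R" for m
    proof -
      have "m \<in> A \<longleftrightarrow> m mod int q \<in> A"
        using empty(2)[of "m mod int q" "m div int q"] by simp
      then show ?thesis using q by (simp add: R_def nat_less_iff)
    qed
    have "finite R" unfolding R_def by simp
    have "A = (\<Union>a\<in>R. {m. [m = int a] (mod int q)})"
    proof (intro set_eqI)
      fix m
      define a where "a = nat (m mod int q)"
      have a: "int a = m mod int q" "a < q" using q by (auto simp: a_def nat_less_iff)
      have "m \<in> (\<Union>b\<in>R. {m. [m = int b] (mod int q)}) \<longleftrightarrow> a \<in> R"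
      proof
        assume "m \<in> (\<Union>b\<in>R. {m. [m = int b] (mod int q)})"
        then obtain b where b: "b \<in> R" "m mod int q = int b mod int q" by (auto simp: cong_def)
        have "int b mod int q = int b" using b(1) by (simp add: R_def)
        with b a show "a \<in> R" by simp
      next
        assume "a \<in> R"
        moreover have "[m = int a] (mod int q)" by (simp add: a(1) cong_def)
        ultimately show "m \<in> (\<Union>b\<in>R. {m. [m = int b] (mod int q)})" by blast
      qed
      then show "m \<in> A \<longleftrightarrow> m \<in> (\<Union>b\<in>R. {m. [m = int b] (mod int q)})"
        using mem[of m] by (simp add: a_def)
    qed
    moreover have "signed_sum k (\<Union>a\<in>R. {m. [m = int a] (mod int q)}) =
        (\<Sum>a\<in>R. signed_sum k {m. [m = int a] (mod int q)})"
      using k \<open>finite R\<close>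
      by (rule signed_sum_Union) (auto simp: R_def cong_def)
    moreover have "signed_sum k {m. [m = int a] (mod int q)} \<in> V_minus k q" if "a \<in> R" for a
    proof -
      have cop: "coprime a q"
      proof (rule ccontr)
        assume "\<not> coprime a q"
        then obtain p where "prime p" "p dvd gcd a q"
          using prime_factor_nat[of "gcd a q"] by (auto simp: coprime_iff_gcd_eq_1)
        then have "prime p" "p dvd a" "p dvd q" by auto
        then have "p \<in> prime_factors q" "int p dvd int a" using q by (auto simp: in_prime_factors_iff)
        then show False using empty(3)[of "int a" p] that by (auto simp: R_def)
      qed
      have a: "1 \<le> a" "a < q" using that cop q by (cases "a = 0"; simp add: R_def)+
      have "1 / real q ^ k * hurwitz_zeta_minus k (real a / real q) \<in> V_minus k q"
        using hurwitz_zeta_minus_in_V_minus_coprime[OF a cop q] by (rule V_minus_scale) auto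
      then show ?thesis using signed_sum_residue_class[OF k a] by simp
    qed
    ultimately show ?case unfolding V_minus_def by (simp add: real_over_rat.span_sum)
  next
    case (insert p D A)
    have p: "prime p" "p > 0" using insert.prems(1) by (auto simp: in_prime_factors_iff prime_gt_0_nat)
    define good where "good A \<longleftrightarrow> (\<forall>m j. m \<in> A \<longleftrightarrow> m + j * int q \<in> A) \<and>
      (\<forall>m. \<forall>r\<in>prime_factors q - insert p D. m \<in> A \<longrightarrow> \<not> int r dvd m)" for A :: "int set"
    define T where "T i A = {m. int p ^ i * m \<in> A}" for i and A :: "int set"
    have goodT: "good (T i A)" if "good A" for i A
    proof -
      have "int p ^ i * m \<in> A \<longleftrightarrow> int p ^ i * (m + j * int q) \<in> A" for m j
      proof -
        have "int p ^ i * (m + j * int q) = int p ^ i * m + (int p ^ i * j) * int q"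
          by (simp only: distrib_left mult.assoc)
        then show ?thesis using that unfolding good_def by metis
      qed
      moreover have "\<not> int r dvd m" if "r \<in> prime_factors q - insert p D" "int p ^ i * m \<in> A" for r m
        using \<open>good A\<close> that dvd_mult[of "int r" m] unfolding good_def by blast
      ultimately show ?thesis unfolding good_def T_def by blast
    qed
    have step: "signed_sum k A - signed_sum k (T 1 A) / real p ^ k \<in> V_minus k q" if "good A" for A
    proof -
      have "signed_sum k {m \<in> A. \<not> int p dvd m} \<in> V_minus k q"
      proof (rule insert.IH)
        fix m j
        have "int p dvd m + j * int q \<longleftrightarrow> int p dvd m"
          using insert.prems(1) by (intro dvd_add_left_iff) (auto simp: in_prime_factors_iff)
        then show "m \<in> {m \<in> A. \<not> int p dvd m} \<longleftrightarrow> m + j * int q \<in> {m \<in> A. \<not> int p dvd m}"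
          using that by (auto simp: good_def)
      qed (use insert.prems(1) that in \<open>auto simp: good_def\<close>)
      then show ?thesis using signed_sum_split[OF k p(2), of A] by (simp add: T_def)
    qed
    have steps: "signed_sum k A - signed_sum k (T i A) / real p ^ (k * i) \<in> V_minus k q" if "good A" for A i
    proof (induction i)
      case 0
      show ?case by (simp add: T_def V_minus_def real_over_rat.span_zero)
    next
      case (Suc i)
      have "1 / real p ^ (k * i) * (signed_sum k (T i A) - signed_sum k (T 1 (T i A)) / real p ^ k) \<in> V_minus k q"
        using step[OF goodT[OF that]] by (rule V_minus_scale) auto
      with Suc have "(signed_sum k A - signed_sum k (T i A) / real p ^ (k * i)) +
          1 / real p ^ (k * i) * (signed_sum k (T i A) - signed_sum k (T 1 (T i A)) / real p ^ k) \<in> V_minus k q"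
        unfolding V_minus_def by (rule real_over_rat.span_add)
      moreover have "T 1 (T i A) = T (Suc i) A" by (simp add: T_def mult_ac)
      ultimately show ?case by (simp add: right_diff_distrib power_add mult.commute)
    qed
    \<comment> \<open>Pigeonhole for the powers of p modulo q. As p divides q, these are only
      eventually periodic, so the repetition starts at T^i A and not at A itself.\<close>
    have "\<not> inj (\<lambda>i. p ^ i mod q)"
    proof
      assume "inj (\<lambda>i. p ^ i mod q)"
      moreover have "finite (range (\<lambda>i. p ^ i mod q))"
        by (rule finite_subset[of _ "{..<q}"]) (use q in auto)
      ultimately show False using finite_imageD infinite_UNIV_nat by blast
    qed
    then obtain i j where "i \<noteq> j" "p ^ i mod q = p ^ j mod q" unfolding inj_def by blast
    then obtain i j where ij: "i < j" "p ^ i mod q = p ^ j mod q"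
      by (metis linorder_neqE_nat)
    have A: "good A" using insert.prems(2,3) unfolding good_def by blast
    define B where "B = T i A"
    have B: "good B" unfolding B_def by (rule goodT[OF A])
    have "int q dvd int p ^ j - int p ^ i"
      using ij(2) by (metis cong_def cong_iff_dvd_diff cong_int_iff of_nat_power)
    then obtain z where z: "int p ^ j - int p ^ i = int q * z" by auto
    have "T (j - i) B = {m. int p ^ j * m \<in> A}"
      using ij(1) by (auto simp: B_def T_def simp flip: mult.assoc power_add)
    also have "\<dots> = B"
    proof -
      have "int p ^ j * m \<in> A \<longleftrightarrow> int p ^ i * m \<in> A" for m
      proof -
        have "int p ^ j * m = int p ^ i * m + (z * m) * int q" using z by (simp add: algebra_simps)
        then show ?thesis using A unfolding good_def by metis
      qed
      then show ?thesis by (simp add: B_def T_def)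
    qed
    finally have "signed_sum k B - signed_sum k B / real p ^ (k * (j - i)) \<in> V_minus k q"
      using steps[OF B, of "j - i"] by simp
    \<comment> \<open>On the periodic set B the relation reads (1 - p^(-k(j-i))) times the sum lies
      in the span, and this rational factor is nonzero.\<close>
    then have "1 / (1 - 1 / real p ^ (k * (j - i))) * (signed_sum k B - signed_sum k B / real p ^ (k * (j - i))) \<in> V_minus k q"
      by (rule V_minus_scale) auto
    moreover have "1 < real p ^ (k * (j - i))"
      using prime_gt_1_nat[OF p(1)] k ij by (intro one_less_power) auto
    then have "1 / (1 - 1 / real p ^ (k * (j - i))) * (signed_sum k B - signed_sum k B / real p ^ (k * (j - i))) = signed_sum k B"
      by (simp add: field_simps)
    ultimately have "signed_sum k B \<in> V_minus k q" by simp
    then have "1 / real p ^ (k * i) * signed_sum k B \<in> V_minus k q" by (rule V_minus_scale) auto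
    with steps[OF A, of i] have "(signed_sum k A - signed_sum k (T i A) / real p ^ (k * i)) + 1 / real p ^ (k * i) * signed_sum k B \<in> V_minus k q"
      unfolding V_minus_def by (rule real_over_rat.span_add)
    then show ?case by (simp add: B_def)
  qed
qed

lemma hurwitz_zeta_minus_in_V_minus:
  assumes "k \<ge> 2" "q \<ge> 3" "1 \<le> a" "a < q"
  shows "hurwitz_zeta_minus k (real a / real q) \<in> V_minus k q"
proof -
  have "signed_sum k {m. [m = int a] (mod int q)} \<in> V_minus k q"
    by (rule signed_sum_in_V_minus[OF assms(1,2) subset_refl]) (auto simp: cong_def)
  then have "real q ^ k * signed_sum k {m. [m = int a] (mod int q)} \<in> V_minus k q"
    by (rule V_minus_scale) auto
  then show ?thesis using assms by (simp add: signed_sum_residue_class)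
qed

section \<open>The linear forms\<close>

lemma prod_shift_eq_fact_binomial: "(\<Prod>i=1..m. i + b) = fact m * (m + b choose m)"
proof -
  have "fact b * (\<Prod>i=1..m. i + b) = (fact (m + b) :: nat)"
    by (induction m) (simp_all add: algebra_simps)
  also have "\<dots> = fact m * fact (m + b - m) * (m + b choose m)"
    by (rule binomial_fact_lemma[symmetric]) simp
  finally show ?thesis by simp
qed

lemma prod_differences_interval:
  fixes J :: nat and j :: int
  assumes "\<bar>j\<bar> \<le> int J"
  shows "(\<Prod>u\<in>{- int J..int J} - {j}. real_of_int u - real_of_int j) =
    (-1) ^ nat (int J + j) * fact (nat (int J + j)) * fact (nat (int J - j))"
proof -
  have split: "{- int J..int J} - {j} = {- int J..j - 1} \<union> {j + 1..int J}" using assms by auto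
  have "(\<Prod>u\<in>{- int J..j - 1}. real_of_int u - real_of_int j) = (\<Prod>i=1..nat (int J + j). - real i)"
    by (rule prod.reindex_bij_witness[of _ "\<lambda>i. j - int i" "\<lambda>u. nat (j - u)"]) auto
  also have "\<dots> = (-1) ^ nat (int J + j) * fact (nat (int J + j))"
    by (simp add: prod_uminus fact_prod)
  finally have 1: "(\<Prod>u\<in>{- int J..j - 1}. real_of_int u - real_of_int j) =
      (-1) ^ nat (int J + j) * fact (nat (int J + j))" .
  have "(\<Prod>u\<in>{j + 1..int J}. real_of_int u - real_of_int j) = (\<Prod>i=1..nat (int J - j). real i)"
    by (rule prod.reindex_bij_witness[of _ "\<lambda>i. j + int i" "\<lambda>u. nat (u - j)"]) auto
  also have "\<dots> = fact (nat (int J - j))" by (simp add: fact_prod)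
  finally show ?thesis unfolding split using 1 by (subst prod.union_disjoint) auto
qed

text \<open>The parameter t stands for r n. The assumption \<open>4 * n \<le> t\<close> keeps q t
  away from the poles, and \<open>big\<close> makes q^(O(t k)) negligible against 2^(q n). The
  constant 30 = 17 + 7 + 6 is what the tail estimate consumes.\<close>

locale hurwitz_form =
  fixes k q t n :: nat
  assumes k: "k \<ge> 2" and q: "q \<ge> 16" and n: "n \<ge> 1" and nt: "4 * n \<le> t"
    and big: "q ^ (30 * t * k) \<le> 2 ^ (q * n)"
begin

text \<open>
  In the variable $T = q s$ the poles are the integers $|u| \le J$ and the rational function is
  $K \cdot \mathrm{numer}(T) / \prod_u (T + u)$ with residues \<open>cf\<close>. The factor \<open>W\<close> makes
  \<open>W * G T\<close> integral at integers. The power $T^{k+1}$ adjusts the parity of the residues so that the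
  values $\zeta^-$, and not $\zeta^+$, appear. Up to sign, \<open>fsum s\<close> is the Taylor coefficient of order
  $k - 1$ of this function at $q s$.
\<close>

definition J where "J = q * n"

definition G :: "real \<Rightarrow> real" where
  "G T = (\<Prod>i\<in>{1..2*t}-{t}. (real q * real i)\<^sup>2 - T\<^sup>2)"

definition W :: real where
  "W = (real q ^ (t - 1) / fact (t - 1) * (real q ^ t / fact t))\<^sup>2"

definition numer :: "real poly" where
  "numer = [:0, 1:] ^ (k + 1) * [:- ((real q * real t)\<^sup>2), 0, 1:] ^ (k - 1) *
     (\<Prod>i\<in>{1..2*t}-{t}. [:(real q * real i)\<^sup>2, 0, -1:]) ^ k"

definition K :: real where "K = fact (2 * J) * W ^ k"

definition cf :: "int \<Rightarrow> real" where
  "cf j = K * (poly numer (- of_int j) / (\<Prod>u\<in>{- int J..int J} - {j}. of_int u - of_int j))"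

definition fsum :: "nat \<Rightarrow> real" where
  "fsum s = (\<Sum>j\<in>{- int J..int J}. cf j / (real q * real s + of_int j) ^ k)"

lemma t: "t \<ge> 4" "n \<le> t" using n nt by auto

lemma W_pos: "W > 0" using q by (simp add: W_def)

lemma K_pos: "K > 0" using W_pos by (simp add: K_def)

lemma poly_numer: "poly numer T = T ^ (k + 1) * (T\<^sup>2 - (real q * real t)\<^sup>2) ^ (k - 1) * G T ^ k"
proof -
  have "poly (\<Prod>i\<in>{1..2*t}-{t}. [:(real q * real i)\<^sup>2, 0, -1:]) T = G T"
    unfolding poly_prod G_def by (intro prod.cong) (auto simp: power2_eq_square)
  then show ?thesis unfolding numer_def poly_mult poly_power by (simp add: power2_eq_square)
qed

text \<open>The left side counts the degree of \<open>numer\<close> factor by factor; its exact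
  value is 4 t k + k - 1.\<close>

lemma exponent_le: "1 * (k + 1) + 2 * (k - 1) + 2 * (2 * t - 1) * k \<le> 4 * t * k + k"
proof -
  have "2 * (2 * t - 1) + 2 = 4 * t" using t by simp
  then have "2 * (2 * t - 1) * k + 2 * k = 4 * t * k" by (metis distrib_right)
  moreover have "1 * (k + 1) + 2 * (k - 1) + x \<le> y + k" if "x + 2 * k = y" for x y :: nat
    using that k by arith
  ultimately show ?thesis by blast
qed

lemma degree_numer: "degree numer \<le> 4 * t * k + k"
proof -
  have a: "degree ([:0, 1:] ^ (k + 1) :: real poly) \<le> 1 * (k + 1)"
    by (rule order.trans[OF degree_power_le]) simp
  have b: "degree ([:- ((real q * real t)\<^sup>2), 0, 1:] ^ (k - 1)) \<le> 2 * (k - 1)"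
    by (rule order.trans[OF degree_power_le]) simp
  have "degree (\<Prod>i\<in>{1..2*t}-{t}. [:(real q * real i)\<^sup>2, 0, -1:]) \<le> 2 * (2 * t - 1)"
    by (rule order.trans[OF degree_prod_sum_le]) (use t in auto)
  then have c: "degree ((\<Prod>i\<in>{1..2*t}-{t}. [:(real q * real i)\<^sup>2, 0, -1:]) ^ k) \<le> 2 * (2 * t - 1) * k"
    by (rule order.trans[OF degree_power_le mult_le_mono1])
  have "degree numer \<le> 1 * (k + 1) + 2 * (k - 1) + 2 * (2 * t - 1) * k"
    unfolding numer_def by (intro order.trans[OF degree_mult_le] add_mono a b c)
  then show ?thesis using exponent_le by simp
qed

section \<open>Integrality, parity and size of the residues\<close>

definition h :: "int \<Rightarrow> nat \<Rightarrow> nat \<Rightarrow> real" where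
  "h z a m = real q ^ m * (\<Prod>i=1..m. real q * real (i + a) + of_int z) / fact m"

lemma h_integral: "h z a m \<in> \<int>"
proof -
  have "int (fact m) dvd int q ^ m * (\<Prod>i=1..m. int q * int i + (int q * int a + z))"
    using q by (intro fact_dvd_prod_arith_progression) auto
  then obtain w where w: "int q ^ m * (\<Prod>i=1..m. int q * int i + (int q * int a + z)) = int (fact m) * w"
    by auto
  have "real q ^ m * (\<Prod>i=1..m. real q * real (i + a) + of_int z) =
      of_int (int q ^ m * (\<Prod>i=1..m. int q * int i + (int q * int a + z)))"
    by (simp add: algebra_simps)
  also have "\<dots> = fact m * of_int w" unfolding w by simp
  finally show ?thesis by (simp add: h_def)
qed

text \<open>The triangle inequality replaces the progression by q times consecutive integers, whose
  product divided by m! is a binomial coefficient.\<close>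

lemma h_bound:
  assumes "\<bar>z\<bar> \<le> int q * int b"
  shows "\<bar>h z a m\<bar> \<le> real q ^ (2 * m) * 2 ^ (m + a + b)"
proof -
  have z: "\<bar>real_of_int z\<bar> \<le> real q * real b"
    using of_int_le_iff[of "\<bar>z\<bar>" "int q * int b", where ?'a = real] assms by simp
  have "\<bar>\<Prod>i=1..m. real q * real (i + a) + of_int z\<bar> \<le> (\<Prod>i=1..m. real q * real (i + (a + b)))"
    unfolding abs_prod
  proof (rule prod_mono)
    fix i
    have "\<bar>real q * real (i + a) + of_int z\<bar> \<le> real q * real (i + a) + real q * real b"
      using z abs_triangle_ineq[of "real q * real (i + a)" "of_int z"] by simp
    then show "0 \<le> \<bar>real q * real (i + a) + of_int z\<bar> \<and> \<bar>real q * real (i + a) + of_int z\<bar> \<le> real q * real (i + (a + b))"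
      by (simp add: algebra_simps)
  qed
  also have "\<dots> = real q ^ m * real (\<Prod>i=1..m. i + (a + b))" by (simp add: prod.distrib)
  also have "\<dots> = real q ^ m * (fact m * real (m + (a + b) choose m))"
    unfolding prod_shift_eq_fact_binomial by simp
  also have "\<dots> \<le> real q ^ m * (fact m * 2 ^ (m + (a + b)))"
  proof (intro mult_left_mono)
    have "(m + (a + b) choose m) \<le> 2 ^ (m + (a + b))" by (rule binomial_le_pow2)
    then show "real (m + (a + b) choose m) \<le> 2 ^ (m + (a + b))" by (metis of_nat_le_iff of_nat_numeral of_nat_power)
  qed auto
  finally have "\<bar>\<Prod>i=1..m. real q * real (i + a) + of_int z\<bar> / fact m \<le> real q ^ m * 2 ^ (m + (a + b))"
    by (simp add: field_simps)
  then have "real q ^ m * (\<bar>\<Prod>i=1..m. real q * real (i + a) + of_int z\<bar> / fact m) \<le> real q ^ m * (real q ^ m * 2 ^ (m + (a + b)))"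
    by (intro mult_left_mono) auto
  then show ?thesis
    by (simp add: h_def abs_mult abs_divide mult_2 power_add add.assoc mult.assoc)
qed

text \<open>The gap at t splits the indices into blocks of lengths t - 1 and t, and each difference
  of squares splits into two progressions. \<open>W\<close> is the product of the four resulting
  normalizations.\<close>

lemma W_G_eq: "W * G (of_int z) = h z 0 (t - 1) * h (- z) 0 (t - 1) * h z t t * h (- z) t t"
proof -
  let ?f = "\<lambda>i. (real q * real i)\<^sup>2 - (real_of_int z)\<^sup>2"
  have f: "?f i = (real q * real i + of_int z) * (real q * real i + of_int (- z))" for i
    by (simp add: power2_eq_square algebra_simps)
  have "{1..2*t} - {t} = {1..t-1} \<union> {t+1..2*t}" using t by auto
  then have "G (of_int z) = (\<Prod>i\<in>{1..t-1}. ?f i) * (\<Prod>i\<in>{t+1..2*t}. ?f i)"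
    unfolding G_def by (simp only:) (intro prod.union_disjoint, auto)
  also have "(\<Prod>i\<in>{t+1..2*t}. ?f i) = (\<Prod>i=1..t. ?f (i + t))"
    by (rule prod.reindex_bij_witness[of _ "\<lambda>i. i + t" "\<lambda>i. i - t"]) auto
  finally show ?thesis
    unfolding f prod.distrib W_def h_def by (simp add: power2_eq_square mult_ac)
qed

lemma W_G_integral: "W * G (of_int z) \<in> \<int>"
  unfolding W_G_eq by (intro Ints_mult h_integral)

lemma W_G_bound:
  assumes "\<bar>z\<bar> \<le> int q * int t"
  shows "\<bar>W * G (of_int z)\<bar> \<le> real q ^ (18 * t)"
proof -
  have z: "\<bar>z\<bar> \<le> int q * int t" "\<bar>- z\<bar> \<le> int q * int t" using assms by auto
  have "\<bar>W * G (of_int z)\<bar> \<le>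
     (real q ^ (2 * (t - 1)) * 2 ^ ((t - 1) + 0 + t)) * (real q ^ (2 * (t - 1)) * 2 ^ ((t - 1) + 0 + t)) *
     (real q ^ (2 * t) * 2 ^ (t + t + t)) * (real q ^ (2 * t) * 2 ^ (t + t + t))"
    unfolding W_G_eq abs_mult by (intro mult_mono h_bound z mult_nonneg_nonneg) auto
  also have "\<dots> \<le> (real q ^ (2 * t) * real q ^ (2 * t)) * (real q ^ (2 * t) * real q ^ (2 * t)) *
     (real q ^ (2 * t) * real q ^ (3 * t)) * (real q ^ (2 * t) * real q ^ (3 * t))"
  proof -
    have p: "(2::real) ^ m \<le> real q ^ m" for m using q by (intro power_mono) auto
    have 2: "2 ^ ((t - 1) + 0 + t) \<le> real q ^ (2 * t)"
      by (rule order.trans[OF p]) (use q in \<open>auto intro!: power_increasing\<close>)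
    have 3: "2 ^ (t + t + t) \<le> real q ^ (3 * t)"
      by (rule order.trans[OF p]) (use q in \<open>auto intro!: power_increasing\<close>)
    have 1: "real q ^ (2 * (t - 1)) \<le> real q ^ (2 * t)" using q by (intro power_increasing) auto
    show ?thesis by (intro mult_mono 1 2 3 order.refl mult_nonneg_nonneg) auto
  qed
  also have "\<dots> = real q ^ (18 * t)" by (simp flip: power_add)
  finally show ?thesis .
qed

text \<open>The factor (2J)! in \<open>K\<close> turns the product of pole differences into a
  binomial coefficient.\<close>

lemma cf_eq:
  assumes "\<bar>j\<bar> \<le> int J"
  shows "cf j = (-1) ^ nat (int J + j) * real (2 * J choose nat (int J + j)) * (- of_int j) ^ (k + 1) *
     ((of_int j)\<^sup>2 - (real q * real t)\<^sup>2) ^ (k - 1) * (W * G (of_int j)) ^ k"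
proof -
  have "real (2 * J choose nat (int J + j)) = fact (2 * J) / (fact (nat (int J + j)) * fact (nat (int J - j)))"
  proof -
    have "2 * J - nat (int J + j) = nat (int J - j)" "nat (int J + j) \<le> 2 * J" using assms by auto
    then show ?thesis using binomial_fact[of "nat (int J + j)" "2 * J", where ?'a = real] by simp
  qed
  moreover have "G (- of_int j) = G (of_int j)" by (simp add: G_def)
  moreover have "x / ((-1) ^ m * a * b) = (-1) ^ m * (x / (a * b))" for m and x a b :: real
    by (cases "even m") auto
  ultimately show ?thesis
    unfolding cf_def prod_differences_interval[OF assms] poly_numer K_def
    by (simp add: power_mult_distrib)
qed

lemma cf_integral:
  assumes "\<bar>j\<bar> \<le> int J"
  shows "cf j \<in> \<int>"
  unfolding cf_eq[OF assms]
  by (intro Ints_mult Ints_power W_G_integral Ints_diff Ints_minus Ints_of_int Ints_of_nat Ints_1)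

text \<open>Apart from T^(k+1) everything in the rational function behaves evenly under T -> -T,
  including the sign (-1)^(J+j).\<close>

lemma cf_reflect:
  assumes "\<bar>j\<bar> \<le> int J"
  shows "cf (- j) = (-1) ^ (k + 1) * cf j"
proof -
  have "nat (int J - j) = 2 * J - nat (int J + j)" using assms by auto
  then have 1: "(2 * J choose nat (int J - j)) = (2 * J choose nat (int J + j))"
    using binomial_symmetric[of "nat (int J + j)" "2 * J"] assms by simp
  \<comment> \<open>Both sides equal J + |j|; adding even amounts shows that the exponents have the
    same parity.\<close>
  have "nat (int J - j) + 2 * nat (max 0 j) = nat (int J + j) + 2 * nat (max 0 (- j))"
    using assms by auto
  then have "(-1 :: real) ^ (nat (int J - j) + 2 * nat (max 0 j)) = (-1) ^ (nat (int J + j) + 2 * nat (max 0 (- j)))"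
    by (rule arg_cong)
  then have 2: "(-1 :: real) ^ nat (int J - j) = (-1) ^ nat (int J + j)" by (simp add: power_add)
  have 3: "(- real_of_int (- j)) ^ (k + 1) = (-1) ^ (k + 1) * (- of_int j) ^ (k + 1)"
    unfolding power_mult_distrib[symmetric] by simp
  have 5: "(real_of_int (- j))\<^sup>2 = (of_int j)\<^sup>2" "int J + - j = int J - j" by simp_all
  have 4: "\<bar>- j\<bar> \<le> int J" using assms by simp
  have "G (of_int (- j)) = G (of_int j)" by (simp add: G_def)
  then show ?thesis unfolding cf_eq[OF assms] cf_eq[OF 4] 5 1 2 3 by (simp only: mult_ac)
qed

text \<open>A multiple q i of q within the range has |i| <= n < t, so it is a zero of
  \<open>G\<close>, or it is 0 and a zero of T^(k+1). Hence the residue class 0, which is no zeta^-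
  value of the required kind, does not enter the form.\<close>

lemma cf_multiple_q:
  assumes "\<bar>j\<bar> \<le> int J" "int q dvd j"
  shows "cf j = 0"
proof -
  obtain i where i: "j = int q * i" using assms(2) by auto
  then have "int q * \<bar>i\<bar> \<le> int q * int n" using assms(1) by (simp add: J_def abs_mult)
  then have "\<bar>i\<bar> \<le> int n" using q by simp
  show ?thesis
  proof (cases "i = 0")
    case True
    then show ?thesis unfolding cf_eq[OF assms(1)] by (simp add: i)
  next
    case False
    have a: "nat \<bar>i\<bar> \<in> {1..2*t}-{t}" using False \<open>\<bar>i\<bar> \<le> int n\<close> nt n by auto
    have b: "(real q * real (nat \<bar>i\<bar>))\<^sup>2 - (of_int j)\<^sup>2 = 0"
      by (simp add: i power_mult_distrib)
    then have "\<exists>i\<in>{1..2*t}-{t}. (real q * real i)\<^sup>2 - (of_int j)\<^sup>2 = 0" using a by blast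
    then have "G (of_int j) = 0" unfolding G_def by (intro prod_zero) auto
    then show ?thesis unfolding cf_eq[OF assms(1)] using k by simp
  qed
qed

lemma nat_le_q_power: "real m \<le> real q ^ m"
proof -
  have "real m \<le> 2 ^ m" by (metis less_exp less_imp_le of_nat_le_iff of_nat_numeral of_nat_power)
  also have "\<dots> \<le> real q ^ m" using q by (intro power_mono) auto
  finally show ?thesis .
qed

lemma qt_power_le: "(real q * real t) ^ m \<le> real q ^ (2 * t * m)"
proof -
  have "real q * real t \<le> real q ^ t * real q ^ t"
    using nat_le_q_power[of t] q t power_increasing[of 1 t "real q"] by (intro mult_mono) auto
  then have "(real q * real t) ^ m \<le> (real q ^ t * real q ^ t) ^ m"
    by (intro power_mono) auto
  then show ?thesis by (simp flip: power_add power_mult add: mult_2)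
qed

text \<open>The exponent 24 is 18 from \<open>W * G\<close> plus 6 from at most 3k factors of size q
  t.\<close>

lemma cf_bound:
  assumes "\<bar>j\<bar> \<le> int J"
  shows "\<bar>cf j\<bar> \<le> 4 ^ J * real q ^ (24 * t * k)"
proof -
  have jt: "\<bar>j\<bar> \<le> int q * int t"
  proof -
    have "int J \<le> int q * int t" using t by (simp add: J_def mult_left_mono)
    with assms show ?thesis by simp
  qed
  then have jt': "\<bar>real_of_int j\<bar> \<le> real q * real t"
    using of_int_le_iff[of "\<bar>j\<bar>" "int q * int t", where ?'a = real] by simp
  have qt1: "1 \<le> real q * real t" using mult_mono[of 1 "real q" 1 "real t"] q t by simp
  have j2: "(real_of_int j)\<^sup>2 \<le> (real q * real t)\<^sup>2" using power_mono[OF jt', of 2] by simp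
  have 1: "real (2 * J choose nat (int J + j)) \<le> 4 ^ J"
  proof -
    have "(2 * J choose nat (int J + j)) \<le> 2 ^ (2 * J)" by (rule binomial_le_pow2)
    then have "real (2 * J choose nat (int J + j)) \<le> 2 ^ (2 * J)" by (metis of_nat_le_iff of_nat_numeral of_nat_power)
    then show ?thesis by (simp add: power_mult)
  qed
  have 2: "\<bar>(real_of_int j)\<^sup>2 - (real q * real t)\<^sup>2\<bar> \<le> (real q * real t)\<^sup>2"
    using j2 zero_le_power2[of "real_of_int j"] by linarith
  have "\<bar>cf j\<bar> = real (2 * J choose nat (int J + j)) * \<bar>real_of_int j\<bar> ^ (k + 1) *
      \<bar>(real_of_int j)\<^sup>2 - (real q * real t)\<^sup>2\<bar> ^ (k - 1) * \<bar>W * G (of_int j)\<bar> ^ k"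
    unfolding cf_eq[OF assms] by (simp add: abs_mult power_abs)
  also have "\<dots> \<le> 4 ^ J * (real q * real t) ^ (k + 1) * ((real q * real t)\<^sup>2) ^ (k - 1) * (real q ^ (18 * t)) ^ k"
    by (intro mult_mono power_mono jt' 1 2 W_G_bound[OF jt] mult_nonneg_nonneg) auto
  also have "\<dots> = 4 ^ J * (real q * real t) ^ (k + 1 + 2 * (k - 1)) * real q ^ (18 * t * k)"
    by (simp only: power_add power_mult mult.assoc)
  also have "\<dots> \<le> 4 ^ J * (real q * real t) ^ (3 * k) * real q ^ (18 * t * k)"
    using qt1 k by (intro mult_mono order.refl power_increasing) auto
  also have "\<dots> \<le> 4 ^ J * real q ^ (2 * t * (3 * k)) * real q ^ (18 * t * k)"
    by (intro mult_mono order.refl qt_power_le) auto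
  also have "\<dots> = 4 ^ J * real q ^ (24 * t * k)" by (simp add: mult_ac flip: power_add)
  finally show ?thesis .
qed

end

section \<open>Taylor coefficients at the points q s: zeros, main term and tail\<close>

lemma fps_l1_bound_quadratic: "fps_l1_bound (fps_of_poly [:a, b, c:]) (\<bar>a\<bar> + (\<bar>b\<bar> + \<bar>c\<bar> * 1) * 1)"
  unfolding fps_of_poly_pCons
  by (intro fps_l1_bound_add fps_l1_bound_mult fps_l1_bound_const fps_l1_bound_X)
    (simp_all add: fps_l1_bound_const[of 0 0, simplified] fps_l1_bound_const)

lemma pcompose_quadratic: "pcompose [:a, 0, c:] [:T, 1:] = [:a + c * T\<^sup>2, 2 * c * T, c :: real:]"
  by (simp add: pcompose_pCons power2_eq_square)

lemma fps_prod_nth_0: "fps_nth (\<Prod>i\<in>S. F i) 0 = (\<Prod>i\<in>S. fps_nth (F i) 0)"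
  for F :: "'i \<Rightarrow> 'a :: comm_ring_1 fps"
  by (induction S rule: infinite_finite_induct) simp_all

lemma pcompose_power: "pcompose (p ^ m) r = pcompose p r ^ m"
  for p r :: "'a :: comm_semiring_1 poly"
  by (induction m) (simp_all add: pcompose_mult pcompose_1)

context hurwitz_form
begin

lemma tk_le_J: "30 * t * k \<le> J"
proof -
  have "(2::nat) ^ (30 * t * k) \<le> q ^ (30 * t * k)" using q by (intro power_mono) auto
  also note big
  finally show ?thesis unfolding J_def by (rule power_le_imp_le_exp[rotated]) simp
qed

lemma k_le_tk: "4 * t * k + k \<le> 30 * t * k"
proof -
  have "1 * k \<le> t * k" using t by (intro mult_right_mono) auto
  moreover have "30 * t * k = 4 * t * k + 26 * (t * k)" by simp
  ultimately show ?thesis by linarith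
qed

definition denom :: "nat \<Rightarrow> real fps" where
  "denom s = (\<Prod>u\<in>{- int J..int J}. fps_inverse_linear (real q * real s + of_int u))"

text \<open>This is why the summation starts at n + 1: from there on the distance to every pole is
  at least q, more than the radius 1 used in the estimates.\<close>

lemma pole_pos:
  assumes "n < s" "u \<in> {- int J..int J}"
  shows "real q * real s + of_int u \<ge> real q"
proof -
  have "- int J \<le> u" using assms(2) by simp
  then have "- real q * real n \<le> of_int u"
    using of_int_le_iff[of "- int J" u, where ?'a = real] by (simp add: J_def)
  moreover have "real q * real s \<ge> real q * (real n + 1)" using assms(1) by (intro mult_left_mono) auto
  ultimately show ?thesis by (simp add: distrib_left)
qed

lemma fsum_eq_coeff:
  assumes "n < s"
  shows "fsum s = (-1) ^ (k - 1) * K * fps_nth (fps_of_poly (pcompose numer [:real q * real s, 1:]) * denom s) (k - 1)"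
proof -
  have "degree numer \<le> J" using degree_numer tk_le_J k_le_tk by linarith
  then have "degree numer < card {- int J..int J}" by simp
  moreover have "real q * real s + of_int u \<noteq> 0" if "u \<in> {- int J..int J}" for u
    using pole_pos[OF assms, of u] that q by auto
  ultimately have "fps_nth (fps_of_poly (pcompose numer [:real q * real s, 1:]) * denom s) (k - 1) =
      (\<Sum>j\<in>{- int J..int J}. poly numer (- of_int j) / (\<Prod>u\<in>{- int J..int J}-{j}. of_int u - of_int j) *
         ((-1) ^ (k - 1) / (real q * real s + of_int j) ^ k))"
    unfolding denom_def using k
    by (subst fps_partial_fractions) (simp_all add: fps_sum_nth fps_inverse_linear_def del: power_Suc)
  then show ?thesis
    unfolding fsum_def cf_def sum_distrib_left
    by (simp add: sum_distrib_left) (intro sum.cong refl, simp flip: power_add power_mult_distrib add: mult_ac)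
qed

text \<open>At q s the numerator has a zero of order k, which kills the coefficient of order k -
  1.\<close>

lemma fsum_zero:
  assumes "n < s" "s \<le> 2 * t" "s \<noteq> t"
  shows "fsum s = 0"
proof -
  let ?T = "real q * real s"
  let ?r = "[:0, 1:] ^ (k + 1) * [:- ((real q * real t)\<^sup>2), 0, 1:] ^ (k - 1) *
     (\<Prod>i\<in>{1..2*t}-{t}-{s}. [:(real q * real i)\<^sup>2, 0, -1:]) ^ k :: real poly"
  have s: "s \<in> {1..2*t}-{t}" using assms by auto
  have "(\<Prod>i\<in>{1..2*t}-{t}. [:(real q * real i)\<^sup>2, 0, -1:]) =
      [:?T\<^sup>2, 0, -1:] * (\<Prod>i\<in>{1..2*t}-{t}-{s}. [:(real q * real i)\<^sup>2, 0, -1:])"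
    by (rule prod.remove[OF _ s]) simp
  then have "numer = [:?T\<^sup>2, 0, -1:] ^ k * ?r"
    unfolding numer_def by (simp only: power_mult_distrib mult_ac)
  then have "pcompose numer [:?T, 1:] = (pcompose [:?T\<^sup>2, 0, -1:] [:?T, 1:]) ^ k * pcompose ?r [:?T, 1:]"
    by (simp only: pcompose_mult pcompose_power)
  also have "pcompose [:?T\<^sup>2, 0, -1:] [:?T, 1:] = [:0, 1:] * [:- 2 * ?T, -1:]"
    unfolding pcompose_quadratic by simp
  finally have eq: "fps_of_poly (pcompose numer [:?T, 1:]) * denom s =
     fps_X ^ k * (fps_of_poly ([:- 2 * ?T, -1:] ^ k * pcompose ?r [:?T, 1:]) * denom s)"
    by (simp only: power_mult_distrib fps_of_poly_mult fps_of_poly_power fps_of_poly_fps_X mult.assoc)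
  show ?thesis
    unfolding fsum_eq_coeff[OF assms(1)] eq fps_X_power_mult_nth using k by simp
qed

text \<open>At the gap, X^(k-1) splits off, so the wanted coefficient is the constant term of the
  remaining factor: a product of values, with neither derivatives nor cancellation.\<close>

lemma abs_fsum_main:
  "\<bar>fsum t\<bar> = fact (2 * J) * (real q * real t) ^ (k + 1) * (2 * (real q * real t)) ^ (k - 1) *
      \<bar>W * G (real q * real t)\<bar> ^ k / (\<Prod>u\<in>{- int J..int J}. real q * real t + of_int u)"
proof -
  have nt': "n < t" using nt n by simp
  let ?T = "real q * real t"
  let ?r = "[:0, 1:] ^ (k + 1) * (\<Prod>i\<in>{1..2*t}-{t}. [:(real q * real i)\<^sup>2, 0, -1:]) ^ k :: real poly"
  have "numer = [:- (?T\<^sup>2), 0, 1:] ^ (k - 1) * ?r"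
    unfolding numer_def by (simp only: mult_ac)
  then have "pcompose numer [:?T, 1:] = (pcompose [:- (?T\<^sup>2), 0, 1:] [:?T, 1:]) ^ (k - 1) * pcompose ?r [:?T, 1:]"
    by (simp only: pcompose_mult pcompose_power)
  also have "pcompose [:- (?T\<^sup>2), 0, 1:] [:?T, 1:] = [:0, 1:] * [:2 * ?T, 1:]"
    unfolding pcompose_quadratic by simp
  finally have "fps_of_poly (pcompose numer [:?T, 1:]) * denom t =
     fps_X ^ (k - 1) * (fps_of_poly ([:2 * ?T, 1:] ^ (k - 1) * pcompose ?r [:?T, 1:]) * denom t)"
    by (simp only: power_mult_distrib fps_of_poly_mult fps_of_poly_power fps_of_poly_fps_X mult.assoc)
  then have "fps_nth (fps_of_poly (pcompose numer [:?T, 1:]) * denom t) (k - 1) =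
     fps_nth (fps_of_poly ([:2 * ?T, 1:] ^ (k - 1) * pcompose ?r [:?T, 1:]) * denom t) 0"
    by (simp only: fps_X_power_mult_nth_last)
  also have "\<dots> = coeff ([:2 * ?T, 1:] ^ (k - 1) * pcompose ?r [:?T, 1:]) 0 * fps_nth (denom t) 0"
    by (simp only: fps_mult_nth_0 fps_of_poly_nth)
  also have "coeff ([:2 * ?T, 1:] ^ (k - 1) * pcompose ?r [:?T, 1:]) 0 = (2 * ?T) ^ (k - 1) * poly ?r ?T"
    by (simp only: poly_0_coeff_0[symmetric] poly_mult poly_power poly_pcompose) simp
  also have "poly ?r ?T = ?T ^ (k + 1) * G ?T ^ k"
  proof -
    have "poly (\<Prod>i\<in>{1..2*t}-{t}. [:(real q * real i)\<^sup>2, 0, -1:]) ?T = G ?T"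
      unfolding poly_prod G_def by (intro prod.cong) (auto simp: power2_eq_square)
    then show ?thesis by (simp only: poly_mult poly_power) simp
  qed
  also have "fps_nth (denom t) 0 = 1 / (\<Prod>u\<in>{- int J..int J}. ?T + of_int u)"
    unfolding denom_def by (simp add: fps_prod_nth_0 fps_inverse_linear_def prod_dividef)
  finally have c: "fps_nth (fps_of_poly (pcompose numer [:?T, 1:]) * denom t) (k - 1) =
      (2 * ?T) ^ (k - 1) * (?T ^ (k + 1) * G ?T ^ k) * (1 / (\<Prod>u\<in>{- int J..int J}. ?T + of_int u))" .
  have "(\<Prod>u\<in>{- int J..int J}. ?T + of_int u) \<ge> 0"
    using pole_pos[OF nt'] q by (intro prod_nonneg) (auto intro: order.trans[of 0 "real q"])
  then show ?thesis
    unfolding fsum_eq_coeff[OF nt'] c using W_pos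
    by (simp add: abs_mult power_abs K_def power_mult_distrib)
qed

text \<open>All zeros of the numerator are at most 2 q t < q s in absolute value, so each quadratic
  factor at q s has coefficient sum at most (q s + 1)^2; the shift by 1 in the denominator comes
  from the radius 1.\<close>

lemma abs_fsum_le:
  assumes "2 * t < s"
  shows "\<bar>fsum s\<bar> \<le> K * (real q * real s + 1) ^ (4 * t * k + k) / (\<Prod>u\<in>{- int J..int J}. real q * real s + of_int u - 1)"
proof -
  have ns: "n < s" using nt n assms by simp
  let ?T = "real q * real s"
  have T: "?T \<ge> 0" by simp
  have quad: "fps_l1_bound (fps_of_poly [:a + c * ?T\<^sup>2, 2 * c * ?T, c:]) ((?T + 1)\<^sup>2)"
    if "\<bar>c\<bar> = 1" "\<bar>a + c * ?T\<^sup>2\<bar> \<le> ?T\<^sup>2" for a c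
  proof -
    have "\<bar>a + c * ?T\<^sup>2\<bar> + (\<bar>2 * c * ?T\<bar> + \<bar>c\<bar> * 1) * 1 \<le> (?T + 1)\<^sup>2"
      using that by (simp add: abs_mult power2_sum)
    then show ?thesis using fps_l1_bound_quadratic[of "a + c * ?T\<^sup>2" "2 * c * ?T" c]
      unfolding fps_l1_bound_def by (meson order.trans)
  qed
  have small: "(real q * real i)\<^sup>2 \<le> ?T\<^sup>2" if "i \<le> 2 * t" for i
    using that assms by (intro power_mono mult_left_mono) auto
  have eq: "fps_of_poly (pcompose numer [:?T, 1:]) = fps_of_poly [:?T, 1:] ^ (k + 1) *
     fps_of_poly [:- ((real q * real t)\<^sup>2) + 1 * ?T\<^sup>2, 2 * 1 * ?T, 1:] ^ (k - 1) *
     (\<Prod>i\<in>{1..2*t}-{t}. fps_of_poly [:(real q * real i)\<^sup>2 + - 1 * ?T\<^sup>2, 2 * - 1 * ?T, -1:]) ^ k"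
  proof -
    have "pcompose [:0, 1:] [:?T, 1:] = [:?T, 1:]" by (simp add: pcompose_pCons)
    then show ?thesis
      unfolding numer_def
      by (simp only: pcompose_mult pcompose_power pcompose_prod pcompose_quadratic
        fps_of_poly_mult fps_of_poly_power fps_of_poly_prod)
  qed
  have lin: "fps_l1_bound (fps_of_poly [:?T, 1:]) (?T + 1)"
    using fps_l1_bound_quadratic[of ?T 1 0] by simp
  have num: "fps_l1_bound (fps_of_poly (pcompose numer [:?T, 1:]))
     ((?T + 1) ^ (k + 1) * ((?T + 1)\<^sup>2) ^ (k - 1) * (\<Prod>i\<in>{1..2*t}-{t}. (?T + 1)\<^sup>2) ^ k)"
    unfolding eq
    by (intro fps_l1_bound_mult fps_l1_bound_power fps_l1_bound_prod lin quad)
      (use small in \<open>auto simp: abs_le_iff\<close>)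
  have pos: "0 < 1 / (?T + of_int u - 1)" if "u \<in> {- int J..int J}" for u
    using pole_pos[OF ns, of u] that q by auto
  have den: "fps_l1_bound (denom s) (\<Prod>u\<in>{- int J..int J}. 1 / (?T + of_int u - 1))"
    unfolding denom_def
  proof (intro fps_l1_bound_prod fps_l1_bound_inverse_linear)
    fix u assume "u \<in> {- int J..int J}"
    then show "?T + of_int u > 1" using pole_pos[OF ns, of u] q by auto
  qed
  have "(?T + 1) ^ (k + 1) * ((?T + 1)\<^sup>2) ^ (k - 1) * (\<Prod>i\<in>{1..2*t}-{t}. (?T + 1)\<^sup>2) ^ k =
     (?T + 1) ^ (1 * (k + 1) + 2 * (k - 1) + 2 * (2 * t - 1) * k)"
    using t by (simp add: power_add power_mult)
  also have "\<dots> \<le> (?T + 1) ^ (4 * t * k + k)"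
    using T by (intro power_increasing exponent_le) auto
  finally have exp: "(?T + 1) ^ (k + 1) * ((?T + 1)\<^sup>2) ^ (k - 1) * (\<Prod>i\<in>{1..2*t}-{t}. (?T + 1)\<^sup>2) ^ k
      \<le> (?T + 1) ^ (4 * t * k + k)" .
  have "\<bar>fsum s\<bar> = K * \<bar>fps_nth (fps_of_poly (pcompose numer [:?T, 1:]) * denom s) (k - 1)\<bar>"
    unfolding fsum_eq_coeff[OF ns] using K_pos by (simp add: abs_mult power_abs)
  also have "\<dots> \<le> K * (((?T + 1) ^ (k + 1) * ((?T + 1)\<^sup>2) ^ (k - 1) * (\<Prod>i\<in>{1..2*t}-{t}. (?T + 1)\<^sup>2) ^ k) *
      (\<Prod>u\<in>{- int J..int J}. 1 / (?T + of_int u - 1)))"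
    using K_pos by (intro mult_left_mono fps_l1_bound_nth fps_l1_bound_mult num den) auto
  also have "\<dots> \<le> K * ((?T + 1) ^ (4 * t * k + k) * (\<Prod>u\<in>{- int J..int J}. 1 / (?T + of_int u - 1)))"
    using K_pos pos by (intro mult_left_mono mult_right_mono exp prod_nonneg) (auto intro: less_imp_le)
  finally show ?thesis by (simp add: prod_dividef)
qed

end

section \<open>Size of the linear forms\<close>

lemma prod_symmetric_interval:
  fixes x :: real
  shows "(\<Prod>u\<in>{- int J..int J}. x + of_int u) = x * (\<Prod>j=1..J. x\<^sup>2 - (real j)\<^sup>2)"
proof (induction J)
  case (Suc J)
  have "{- int (Suc J)..int (Suc J)} = insert (int (Suc J)) (insert (- int (Suc J)) {- int J..int J})"
    by auto
  then have "(\<Prod>u\<in>{- int (Suc J)..int (Suc J)}. x + of_int u) =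
      (x + real (Suc J)) * ((x - real (Suc J)) * (\<Prod>u\<in>{- int J..int J}. x + of_int u))"
    by (simp add: add.commute)
  then show ?case unfolding Suc by (simp add: power2_eq_square algebra_simps)
qed simp

text \<open>A single term of the exponential series. With the next lemma this is Stirling's formula
  up to a factor e m.\<close>

lemma power_self_le_exp_fact: "real m ^ m \<le> exp (real m) * fact m"
proof -
  have "inverse (fact m) * real m ^ m \<le> exp (real m)"
    using sum_le_suminf[OF summable_exp_generic[of "real m"], of "{m}"] by (simp add: exp_def)
  then show ?thesis by (simp add: field_simps)
qed

text \<open>The induction step amounts to e <= (1 + 1/m)^(m+1).\<close>

lemma fact_le_power_exp:
  assumes "m \<ge> 1"
  shows "fact m \<le> exp 1 * real m * (real m / exp 1) ^ m"
  using assms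
proof (induction m rule: nat_induct_at_least)
  case (Suc m)
  have "1 / real (Suc m) \<le> ln (1 + 1 / real m)"
  proof -
    have "ln (real m / real (Suc m)) \<le> real m / real (Suc m) - 1"
      using Suc by (intro ln_le_minus_one) auto
    also have "\<dots> = - (1 / real (Suc m))" by (simp add: field_simps)
    also have "ln (real m / real (Suc m)) = - ln (1 + 1 / real m)"
      using Suc by (simp add: ln_div add_divide_distrib[symmetric] field_simps flip: ln_inverse)
    finally show ?thesis by simp
  qed
  then have "1 \<le> real (Suc m) * ln (1 + 1 / real m)" by (simp add: field_simps)
  then have "exp 1 \<le> exp (real (Suc m) * ln (1 + 1 / real m))" by simp
  also have "\<dots> = (1 + 1 / real m) ^ Suc m"
    using Suc by (simp only: exp_of_nat_mult) (simp add: add_pos_nonneg)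
  also have "1 + 1 / real m = real (Suc m) / real m" using Suc by (simp add: field_simps)
  finally have e: "exp 1 * real m ^ Suc m \<le> real (Suc m) ^ Suc m"
    using Suc by (simp add: power_divide field_simps)
  have "fact (Suc m) \<le> real (Suc m) * (exp 1 * real m * (real m / exp 1) ^ m)"
    using Suc.IH by (simp add: mult_left_mono del: of_nat_Suc)
  also have "\<dots> = exp 1 * real (Suc m) * (exp 1 * real m ^ Suc m) / exp 1 ^ Suc m"
    by (simp add: power_divide)
  also have "\<dots> \<le> exp 1 * real (Suc m) * real (Suc m) ^ Suc m / exp 1 ^ Suc m"
    using e by (intro divide_right_mono mult_left_mono) auto
  also have "\<dots> = exp 1 * real (Suc m) * (real (Suc m) / exp 1) ^ Suc m"
    by (simp add: power_divide)
  finally show ?case .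
qed simp

text \<open>With t = r n the condition reads 2 q <= r^2. Seen from q t, the poles then nearly form a
  single point: their product \<open>D\<close> agrees with (q t)^(2J+1) up to 2^n, a loss not
  exponential in q.\<close>

locale hurwitz_form_large = hurwitz_form +
  assumes qnt: "2 * q * n\<^sup>2 \<le> t\<^sup>2"
begin

definition D :: real where "D = (\<Prod>u\<in>{- int J..int J}. real q * real t + of_int u)"

definition M :: real where "M = \<bar>fsum t\<bar>"

lemma J_le: "real J * 4 \<le> real q * real t"
proof -
  have "real J * 4 = real q * real (4 * n)" by (simp add: J_def)
  also have "\<dots> \<le> real q * real t" using nt by (intro mult_left_mono) auto
  finally show ?thesis .
qed

lemma J_ge: "J \<ge> 1" using q n by (simp add: J_def)

lemma qt_ge: "real q * real t \<ge> 16 * 4"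
  using q t by (intro mult_mono) auto

lemma D_pos: "D > 0"
  unfolding D_def
proof (rule prod_pos)
  fix u assume "u \<in> {- int J..int J}"
  then show "0 < real q * real t + of_int u"
    using pole_pos[of t u] q nt n by auto
qed

lemma D_le: "D \<le> (real q * real t) ^ (2 * J + 1)"
proof -
  have le: "real j \<le> real q * real t" if "j \<in> {1..J}" for j
    using that J_le J_ge by (auto intro: order.trans[of _ "real J"])
  have "(\<Prod>j=1..J. (real q * real t)\<^sup>2 - (real j)\<^sup>2) \<le> (\<Prod>j=1..J. (real q * real t)\<^sup>2)"
  proof (rule prod_mono)
    fix j assume "j \<in> {1..J}"
    from power_mono[OF le[OF this], of 2]
    show "0 \<le> (real q * real t)\<^sup>2 - (real j)\<^sup>2 \<and> (real q * real t)\<^sup>2 - (real j)\<^sup>2 \<le> (real q * real t)\<^sup>2"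
      by simp
  qed
  also have "\<dots> = (real q * real t) ^ (2 * J)" by (simp add: power_mult)
  finally have "real q * real t * (\<Prod>j=1..J. (real q * real t)\<^sup>2 - (real j)\<^sup>2) \<le> real q * real t * (real q * real t) ^ (2 * J)"
    by (intro mult_left_mono) auto
  then show ?thesis unfolding D_def prod_symmetric_interval by simp
qed

text \<open>Pairing u with -u, each factor is at least (q t)^2 (1 - \<theta>) with \<theta> =
  (n/t)^2. Bernoulli's inequality is applied to q factors at a time, and J = q n gives n such
  groups, each costing 2.\<close>

lemma D_ge: "(real q * real t) ^ (2 * J + 1) \<le> 2 ^ n * D"
proof -
  let ?x = "real q * real t"
  define \<theta> where "\<theta> = (real n / real t)\<^sup>2"
  have "real (2 * q * n\<^sup>2) \<le> real (t\<^sup>2)" using qnt by (simp only: of_nat_le_iff)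
  then have th: "real q * \<theta> \<le> 1 / 2" using t by (simp add: \<theta>_def field_simps)
  have th0: "0 \<le> \<theta>" by (simp add: \<theta>_def)
  have th1: "\<theta> \<le> 1"
    using t unfolding \<theta>_def by (intro power_le_one) (auto simp: field_simps)
  have "1 / 2 \<le> 1 - real q * \<theta>" using th by simp
  also have "\<dots> \<le> (1 - \<theta>) ^ q"
    using Bernoulli_inequality[of "- \<theta>" q] th1 by simp
  finally have "(1 / 2) ^ n \<le> ((1 - \<theta>) ^ q) ^ n" by (intro power_mono) auto
  then have B: "(1 / 2) ^ n \<le> (1 - \<theta>) ^ J" by (simp add: J_def power_mult)
  have "(\<Prod>j=1..J. ?x\<^sup>2 * (1 - \<theta>)) \<le> (\<Prod>j=1..J. ?x\<^sup>2 - (real j)\<^sup>2)"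
  proof (intro prod_mono conjI)
    fix j assume "j \<in> {1..J}"
    then have "(real j)\<^sup>2 \<le> (real J)\<^sup>2" by (intro power_mono) auto
    also have "\<dots> = ?x\<^sup>2 * \<theta>" using t by (simp add: J_def \<theta>_def power_mult_distrib power_divide)
    finally show "?x\<^sup>2 * (1 - \<theta>) \<le> ?x\<^sup>2 - (real j)\<^sup>2" by (simp add: algebra_simps)
    show "0 \<le> ?x\<^sup>2 * (1 - \<theta>)" using th1 by simp
  qed
  then have "?x ^ (2 * J) * (1 - \<theta>) ^ J \<le> (\<Prod>j=1..J. ?x\<^sup>2 - (real j)\<^sup>2)"
    by (simp add: power_mult_distrib power_mult)
  moreover have "?x ^ (2 * J) * (1 / 2) ^ n \<le> ?x ^ (2 * J) * (1 - \<theta>) ^ J"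
    using B by (intro mult_left_mono) auto
  ultimately have "?x * (?x ^ (2 * J) * (1 / 2) ^ n) \<le> ?x * (\<Prod>j=1..J. ?x\<^sup>2 - (real j)\<^sup>2)"
    by (intro mult_left_mono) auto
  then have "?x ^ (2 * J + 1) * (1 / 2) ^ n \<le> D" unfolding D_def prod_symmetric_interval by simp
  then have "2 ^ n * (?x ^ (2 * J + 1) * (1 / 2) ^ n) \<le> 2 ^ n * D" by (intro mult_left_mono) auto
  then show ?thesis by (simp add: power_divide)
qed

text \<open>A nonzero integer: integrality provides the lower bound for the main term without
  further analysis.\<close>

lemma W_G_main_ge: "1 \<le> \<bar>W * G (real q * real t)\<bar>"
proof -
  have "W * G (of_int (int q * int t)) \<in> \<int>" by (rule W_G_integral)
  then have "W * G (real q * real t) \<in> \<int>" by simp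
  moreover have "G (real q * real t) \<noteq> 0"
    unfolding G_def using q t by (auto simp: power_mult_distrib)
  ultimately show ?thesis using W_pos Ints_nonzero_abs_ge1[of "W * G (real q * real t)"] by simp
qed

lemma W_G_main_le: "\<bar>W * G (real q * real t)\<bar> \<le> real q ^ (18 * t)"
  using W_G_bound[of "int q * int t"] by simp

lemma M_eq: "M = fact (2 * J) * (real q * real t) ^ (k + 1) * (2 * (real q * real t)) ^ (k - 1) *
      \<bar>W * G (real q * real t)\<bar> ^ k / D"
  unfolding M_def D_def by (rule abs_fsum_main)

lemma M_ge: "fact (2 * J) * (real q * real t) / D \<le> M"
proof -
  have "fact (2 * J) * (real q * real t) ^ 1 * 1 * 1 / D \<le> M"
    unfolding M_eq using D_pos qt_ge W_G_main_ge k
    by (intro divide_right_mono mult_mono power_increasing one_le_power mult_nonneg_nonneg) auto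
  then show ?thesis by simp
qed

lemma M_pos: "M > 0"
proof -
  have "0 < fact (2 * J) * (real q * real t) / D" using D_pos qt_ge by simp
  then show ?thesis using M_ge by linarith
qed

lemma ratio_eq: "2 * real n / (exp 1 * real t) = real (2 * J) / (exp 1 * (real q * real t))"
  using q by (simp add: J_def)

lemma M_lower: "(2 * real n / (exp 1 * real t)) ^ (2 * J) \<le> M"
proof -
  have "(2 * real n / (exp 1 * real t)) ^ (2 * J) = real (2 * J) ^ (2 * J) / (exp 1 ^ (2 * J) * (real q * real t) ^ (2 * J))"
    unfolding ratio_eq by (simp only: power_divide power_mult_distrib)
  also have "\<dots> \<le> (exp (real (2 * J)) * fact (2 * J)) / (exp 1 ^ (2 * J) * (real q * real t) ^ (2 * J))"
    by (intro divide_right_mono power_self_le_exp_fact) auto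
  also have "exp (real (2 * J)) = exp 1 ^ (2 * J)" by (metis exp_of_nat_mult mult.right_neutral)
  also have "exp 1 ^ (2 * J) * fact (2 * J) / (exp 1 ^ (2 * J) * (real q * real t) ^ (2 * J)) =
      fact (2 * J) * (real q * real t) / (real q * real t) ^ (2 * J + 1)"
  proof -
    have "e * f / (e * x ^ m) = f * x / x ^ (m + 1)" if "x \<noteq> 0" "e \<noteq> 0" for e f x :: real and m
      using that by simp
    then show ?thesis using q t by simp
  qed
  also have "\<dots> \<le> fact (2 * J) * (real q * real t) / D"
    using D_le D_pos by (intro divide_left_mono) auto
  also have "\<dots> \<le> M" by (rule M_ge)
  finally show ?thesis .
qed

lemma two_qt_power_le: "(2 * (real q * real t)) ^ m \<le> real q ^ (3 * t * m)"
proof -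
  have "2 \<le> real q" using q by simp
  also have "\<dots> \<le> real q ^ t" using q t by (intro self_le_power) auto
  finally have a: "2 \<le> real q ^ t" .
  have b: "real q * real t \<le> real q ^ (2 * t * 1)" using qt_power_le[of 1] by (simp only: power_one_right)
  have "(2 * (real q * real t)) ^ m \<le> (real q ^ t * real q ^ (2 * t * 1)) ^ m"
    by (rule power_mono[OF mult_mono[OF a b]]) simp_all
  also have "\<dots> = real q ^ ((t + 2 * t * 1) * m)" by (simp only: power_add power_mult)
  also have "(t + 2 * t * 1) * m = 3 * t * m" by simp
  finally show ?thesis .
qed

lemma k_le: "k \<le> t * k"
  using t by simp

text \<open>The exponent 25 is 18 from \<open>W * G\<close>, 6 from the 2k factors 2 q t and 1 from
  the loss 2^n in \<open>D\<close>.\<close>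

lemma M_upper: "M \<le> 6 * real q ^ (25 * t * k) * (2 * real n / (exp 1 * real t)) ^ (2 * J)"
proof -
  let ?x = "real q * real t"
  have "M \<le> fact (2 * J) * (?x ^ (k + 1) * (2 * ?x) ^ (k - 1) * (real q ^ (18 * t)) ^ k) / D"
    unfolding M_eq mult.assoc using D_pos W_G_main_le by (intro divide_right_mono mult_left_mono power_mono) auto
  also have "\<dots> \<le> fact (2 * J) * ((2 * ?x) ^ (k + 1) * (2 * ?x) ^ (k - 1) * (real q ^ (18 * t)) ^ k) / D"
    using D_pos by (intro divide_right_mono mult_left_mono mult_right_mono power_mono) auto
  also have "(2 * ?x) ^ (k + 1) * (2 * ?x) ^ (k - 1) = (2 * ?x) ^ (2 * k)"
  proof -
    have "k + 1 + (k - 1) = 2 * k" using k by simp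
    then show ?thesis by (simp only: flip: power_add)
  qed
  also have "fact (2 * J) * ((2 * ?x) ^ (2 * k) * (real q ^ (18 * t)) ^ k) / D \<le>
      fact (2 * J) * (real q ^ (3 * t * (2 * k)) * (real q ^ (18 * t)) ^ k) / D"
    using D_pos by (intro divide_right_mono mult_left_mono mult_right_mono two_qt_power_le) auto
  also have "real q ^ (3 * t * (2 * k)) * (real q ^ (18 * t)) ^ k = real q ^ (24 * t * k)"
  proof -
    have "3 * t * (2 * k) + 18 * t * k = 24 * t * k" by simp
    then show ?thesis by (simp only: flip: power_add power_mult)
  qed
  also have "fact (2 * J) * real q ^ (24 * t * k) / D \<le> fact (2 * J) * real q ^ (24 * t * k) / (?x ^ (2 * J + 1) / 2 ^ n)"
  proof (intro divide_left_mono)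
    show "?x ^ (2 * J + 1) / 2 ^ n \<le> D" using D_ge by (simp add: divide_le_eq mult.commute)
    show "0 < D * (?x ^ (2 * J + 1) / 2 ^ n)" using D_pos qt_ge by (intro mult_pos_pos divide_pos_pos) auto
  qed auto
  also have "\<dots> = real q ^ (24 * t * k) * 2 ^ n * (fact (2 * J) / ?x ^ (2 * J + 1))" by simp
  also have "\<dots> \<le> real q ^ (24 * t * k) * real q ^ (t * k) * (6 * (2 * real n / (exp 1 * real t)) ^ (2 * J))"
  proof (intro mult_mono order.refl mult_nonneg_nonneg)
    have "(2::real) ^ n \<le> real q ^ n" using q by (intro power_mono) auto
    also have "\<dots> \<le> real q ^ (t * k)"
    proof (rule power_increasing)
      have "n * 1 \<le> t * k" using nt k by (intro mult_mono) auto
      then show "n \<le> t * k" by simp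
    qed (use q in simp)
    finally show "2 ^ n \<le> real q ^ (t * k)" .
    have "fact (2 * J) / ?x ^ (2 * J + 1) \<le> exp 1 * real (2 * J) * (real (2 * J) / exp 1) ^ (2 * J) / ?x ^ (2 * J + 1)"
    proof (rule divide_right_mono)
      show "fact (2 * J) \<le> exp 1 * real (2 * J) * (real (2 * J) / exp 1) ^ (2 * J)"
        using J_ge by (intro fact_le_power_exp) simp
      show "0 \<le> ?x ^ (2 * J + 1)" by (intro zero_le_power) simp
    qed
    also have "\<dots> = exp 1 * (real (2 * J) / ?x) * ((real (2 * J) / exp 1) ^ (2 * J) / ?x ^ (2 * J))"
    proof -
      have "e * a * p / x ^ (m + 1) = e * (a / x) * (p / x ^ m)" for e a p x :: real and m by simp
      then show ?thesis .
    qed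
    also have "(real (2 * J) / exp 1) ^ (2 * J) / ?x ^ (2 * J) = (2 * real n / (exp 1 * real t)) ^ (2 * J)"
      unfolding ratio_eq by (simp only: power_divide power_mult_distrib divide_divide_eq_left)
    also have "exp 1 * (real (2 * J) / ?x) * (2 * real n / (exp 1 * real t)) ^ (2 * J)
        \<le> (3 * 2) * (2 * real n / (exp 1 * real t)) ^ (2 * J)"
    proof (intro mult_right_mono mult_mono)
      show "real (2 * J) / ?x \<le> 2" using J_le qt_ge by (simp add: divide_le_eq)
    qed (use exp_le in auto)
    finally show "fact (2 * J) / ?x ^ (2 * J + 1) \<le> 6 * (2 * real n / (exp 1 * real t)) ^ (2 * J)"
      by simp
  qed auto
  also have "\<dots> = 6 * real q ^ (25 * t * k) * (2 * real n / (exp 1 * real t)) ^ (2 * J)"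
  proof -
    have "24 * t * k + t * k = 25 * t * k" by simp
    then have "real q ^ (24 * t * k) * real q ^ (t * k) = real q ^ (25 * t * k)"
      by (simp only: flip: power_add)
    then show ?thesis by (simp only: mult_ac)
  qed
  finally show ?thesis .
qed

text \<open>The decay t^(-4t) is retained because it has to cancel the powers of t in the
  tail.\<close>

lemma W_le: "W \<le> real q ^ (6 * t) * (3 / real t) ^ (4 * t)"
proof -
  have f: "fact t = real t * fact (t - 1)" using t by (simp add: fact_reduce)
  have "real t ^ t \<le> 3 ^ t * fact t"
  proof -
    have "real t ^ t \<le> exp 1 ^ t * fact t"
      using power_self_le_exp_fact[of t] by (metis exp_of_nat_mult mult.right_neutral)
    also have "\<dots> \<le> 3 ^ t * fact t" using exp_le by (intro mult_right_mono power_mono) auto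
    finally show ?thesis .
  qed
  then have e: "1 / fact t \<le> (3 / real t) ^ t" using t by (simp add: power_divide field_simps)
  have "real q ^ (t - 1) / fact (t - 1) * (real q ^ t / fact t) = (real q ^ (t - 1) * real q ^ t * real t) * ((1 / fact t) * (1 / fact t))"
    using t unfolding f by (simp add: field_simps)
  also have "\<dots> \<le> (real q ^ t * real q ^ t * real q ^ t) * ((3 / real t) ^ t * (3 / real t) ^ t)"
    using q nat_le_q_power[of t] by (intro mult_mono e power_increasing mult_nonneg_nonneg) auto
  finally have "W \<le> ((real q ^ t * real q ^ t * real q ^ t) * ((3 / real t) ^ t * (3 / real t) ^ t))\<^sup>2"
    unfolding W_def by (intro power_mono) auto
  also have "\<dots> = real q ^ (6 * t) * (3 / real t) ^ (4 * t)"
    by (simp only: power_mult_distrib flip: power_add power_mult) (simp add: mult_ac)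
  finally show ?thesis .
qed

end

section \<open>The tail of the series\<close>

lemma sums_reciprocal_products: "(\<lambda>m. 1 / real (Suc m) - 1 / real (Suc (Suc m))) sums 1"
proof -
  have "(\<lambda>m. 1 / real (Suc m)) \<longlonglongrightarrow> 0" by (rule LIMSEQ_Suc[OF lim_1_over_n])
  from telescope_sums'[OF this] show ?thesis by simp
qed

context hurwitz_form_large
begin

text \<open>The bound for W^k cancels the t^(4tk) contained in (q s)^(4tk), leaving powers of q and
  of s / t. The exponents are 17 = 6 + 8 + 3 and 5 = 4 + 1.\<close>

lemma tail_numerator:
  assumes "2 * t < s"
  shows "W ^ k * (real q * real s + 1) ^ (4 * t * k + k) \<le> real q ^ (17 * t * k) * (real s / real t) ^ (5 * t * k)"
proof -
  define y where "y = real s / real t"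
  have y: "y \<ge> 2" "real s = real t * y" using assms t by (auto simp: y_def field_simps)
  have "W ^ k \<le> (real q ^ (6 * t) * (3 / real t) ^ (4 * t)) ^ k"
    using W_le W_pos by (intro power_mono) auto
  also have "\<dots> = real q ^ (6 * t * k) * (3 / real t) ^ (4 * t * k)"
    by (simp only: power_mult_distrib power_mult)
  finally have w: "W ^ k \<le> real q ^ (6 * t * k) * (3 / real t) ^ (4 * t * k)" .
  have "1 * 1 \<le> real q * real s" using assms q by (intro mult_mono) auto
  then have "real q * real s + 1 \<le> 2 * (real q * real t) * y" by (simp add: y(2) mult_ac)
  then have "(real q * real s + 1) ^ (4 * t * k + k) \<le> (2 * (real q * real t) * y) ^ (4 * t * k + k)"
    by (intro power_mono) auto
  also have "\<dots> = (2 * (real q * real t) * y) ^ (4 * t * k) * ((2 * (real q * real t)) ^ k * y ^ k)"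
    by (simp only: power_add power_mult_distrib)
  also have "\<dots> \<le> (2 * (real q * real t) * y) ^ (4 * t * k) * (real q ^ (3 * t * k) * y ^ (t * k))"
    using y k_le by (intro mult_left_mono mult_mono two_qt_power_le power_increasing) auto
  finally have x: "(real q * real s + 1) ^ (4 * t * k + k) \<le> (2 * (real q * real t) * y) ^ (4 * t * k) * (real q ^ (3 * t * k) * y ^ (t * k))" .
  have "W ^ k * (real q * real s + 1) ^ (4 * t * k + k) \<le>
     (real q ^ (6 * t * k) * (3 / real t) ^ (4 * t * k)) * ((2 * (real q * real t) * y) ^ (4 * t * k) * (real q ^ (3 * t * k) * y ^ (t * k)))"
    using y W_pos by (intro mult_mono w x) auto
  also have "\<dots> = real q ^ (6 * t * k) * ((3 / real t) * (2 * (real q * real t) * y)) ^ (4 * t * k) * (real q ^ (3 * t * k) * y ^ (t * k))"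
    by (simp only: power_mult_distrib mult.assoc)
  also have "(3 / real t) * (2 * (real q * real t) * y) = 6 * real q * y" using t by simp
  also have "real q ^ (6 * t * k) * (6 * real q * y) ^ (4 * t * k) * (real q ^ (3 * t * k) * y ^ (t * k)) \<le>
     real q ^ (6 * t * k) * (real q ^ 2 * y) ^ (4 * t * k) * (real q ^ (3 * t * k) * y ^ (t * k))"
  proof -
    have "6 * real q * y \<le> real q ^ 2 * y"
      using y q by (intro mult_right_mono) (auto simp: power2_eq_square)
    then show ?thesis using y by (intro mult_right_mono mult_left_mono power_mono) auto
  qed
  also have "\<dots> = real q ^ (6 * t * k + 2 * (4 * t * k) + 3 * t * k) * y ^ (4 * t * k + t * k)"
  proof -
    have "(real q ^ 2 * y) ^ m = real q ^ (2 * m) * y ^ m" for m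
      by (simp only: power_mult_distrib power_mult)
    then show ?thesis by (simp only: power_add mult_ac)
  qed
  also have "6 * t * k + 2 * (4 * t * k) + 3 * t * k = 17 * t * k" by simp
  also have "4 * t * k + t * k = 5 * t * k" by simp
  finally show ?thesis by (simp add: y_def)
qed

text \<open>With y = s / t, each factor grows by at least 3y/4 in comparison with \<open>D\<close>,
  and (3y/4)^2 >= y for y >= 2. Giving up half of the exponent is harmless since t k is small
  compared with J.\<close>

lemma tail_denominator:
  assumes "2 * t < s"
  shows "(real s / real t) ^ J * D \<le> (\<Prod>u\<in>{- int J..int J}. real q * real s + of_int u - 1)"
proof -
  define y where "y = real s / real t"
  have y: "y \<ge> 2" "real s = real t * y" using assms t by (auto simp: y_def field_simps)
  have y2: "y \<le> (3 / 4 * y) ^ 2"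
  proof -
    have "16 * y \<le> 9 * y * y" using y(1) by (intro mult_right_mono) auto
    then show ?thesis by (simp add: power2_eq_square)
  qed
  have "y ^ J * 1 \<le> ((3 / 4 * y) ^ 2) ^ J * (3 / 4 * y)"
    using y y2 by (intro mult_mono power_mono) auto
  also have "\<dots> = (3 / 4 * y) ^ (2 * J + 1)" by (simp only: power_add power_mult power_one_right)
  finally have "y ^ J * D \<le> (3 / 4 * y) ^ (2 * J + 1) * D"
    using D_pos by (intro mult_right_mono) auto
  also have "\<dots> = (\<Prod>u\<in>{- int J..int J}. 3 / 4 * y * (real q * real t + of_int u))"
  proof -
    have "(\<Prod>u\<in>S. c * f u) = c ^ card S * prod f S" for c :: real and f and S :: "int set"
      by (simp add: prod.distrib)
    moreover have "card {- int J..int J} = 2 * J + 1" by simp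
    ultimately show ?thesis by (simp only: D_def)
  qed
  also have "\<dots> \<le> (\<Prod>u\<in>{- int J..int J}. real q * real s + of_int u - 1)"
  proof (intro prod_mono conjI)
    fix u assume u: "u \<in> {- int J..int J}"
    have "real_of_int u \<le> real J"
      using u of_int_le_iff[of u "int J", where ?'a = real] by simp
    then have "(3 / 4 * y - 1) * real_of_int u \<le> (3 / 4 * y - 1) * real J"
      using y by (intro mult_left_mono) auto
    also have "\<dots> \<le> (3 / 4 * y) * real J" by (intro mult_right_mono) auto
    also have "\<dots> \<le> (3 / 4 * y) * (real q * real t / 4)"
      using y J_le by (intro mult_left_mono) auto
    also have "\<dots> = 3 / 16 * (real q * real s)" by (simp add: y(2))
    also have "\<dots> \<le> 1 / 4 * (real q * real s) - 1"
    proof -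
      have "16 * 1 \<le> real q * real s" using assms q by (intro mult_mono) auto
      then show ?thesis by simp
    qed
    finally have "3 / 4 * y * of_int u - of_int u \<le> 1 / 4 * (real q * real s) - 1"
      by (simp add: left_diff_distrib)
    moreover have "3 / 4 * y * (real q * real t + of_int u) = 3 / 4 * (real q * real s) + 3 / 4 * y * of_int u"
      by (simp add: y(2) distrib_left)
    ultimately show "3 / 4 * y * (real q * real t + of_int u) \<le> real q * real s + of_int u - 1" by linarith
    show "0 \<le> 3 / 4 * y * (real q * real t + of_int u)"
      using y pole_pos[of t u] u q nt n by (intro mult_nonneg_nonneg) auto
  qed
  finally show ?thesis by (simp add: y_def)
qed

lemma abs_fsum_tail:
  assumes "2 * t < s"
  shows "\<bar>fsum s\<bar> \<le> M / 2 * (1 / (real s)\<^sup>2)"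
proof -
  define y where "y = real s / real t"
  have y: "y \<ge> 2" using assms t by (auto simp: y_def field_simps)
  have D: "0 < y ^ J * D" using y D_pos by simp
  have "5 * t * k + 2 \<le> J"
  proof -
    have "1 * 2 \<le> t * k" using t k by (intro mult_mono) auto
    moreover have "30 * t * k = 5 * t * k + 25 * (t * k)" by simp
    ultimately show ?thesis using tk_le_J by linarith
  qed
  \<comment> \<open>The powers of y left over after the numerator has used y^(5tk) and y^2 has been
    reserved for convergence; by \<open>big\<close> they outweigh all powers of q.\<close>
  define r where "r = J - (5 * t * k + 2)"
  have J: "J = 5 * t * k + 2 + r" using \<open>5 * t * k + 2 \<le> J\<close> by (simp add: r_def)
  have r: "real q ^ (24 * t * k) \<le> 2 ^ r"
  proof -
    have "real q ^ (30 * t * k) \<le> 2 ^ J"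
      using of_nat_le_iff[of "q ^ (30 * t * k)" "2 ^ (q * n)", where ?'a = real] big by (simp add: J_def)
    also have "\<dots> = 2 ^ (5 * t * k + 2) * 2 ^ r" by (simp only: J power_add)
    also have "\<dots> \<le> real q ^ (6 * t * k) * 2 ^ r"
    proof (rule mult_right_mono)
      have "1 * 2 \<le> t * k" using t k by (intro mult_mono) auto
      moreover have "6 * t * k = 5 * t * k + t * k" by simp
      ultimately have "5 * t * k + 2 \<le> 6 * t * k" by linarith
      then have "(2::real) ^ (5 * t * k + 2) \<le> 2 ^ (6 * t * k)" by (rule power_increasing) simp
      also have "\<dots> \<le> real q ^ (6 * t * k)" using q by (intro power_mono) auto
      finally show "(2::real) ^ (5 * t * k + 2) \<le> real q ^ (6 * t * k)" .
    qed simp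
    finally have "real q ^ (30 * t * k) \<le> real q ^ (6 * t * k) * 2 ^ r" .
    moreover have "30 * t * k = 6 * t * k + 24 * t * k" by simp
    ultimately have "real q ^ (6 * t * k) * real q ^ (24 * t * k) \<le> real q ^ (6 * t * k) * 2 ^ r"
      by (simp only: power_add)
    then show ?thesis using q by (subst (asm) mult_le_cancel_left_pos) auto
  qed
  have "\<bar>fsum s\<bar> \<le> K * (real q * real s + 1) ^ (4 * t * k + k) / (\<Prod>u\<in>{- int J..int J}. real q * real s + of_int u - 1)"
    by (rule abs_fsum_le[OF assms])
  also have "\<dots> \<le> K * (real q * real s + 1) ^ (4 * t * k + k) / (y ^ J * D)"
  proof (rule divide_left_mono)
    show le: "y ^ J * D \<le> (\<Prod>u\<in>{- int J..int J}. real q * real s + of_int u - 1)"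
      unfolding y_def by (rule tail_denominator[OF assms])
    show "0 \<le> K * (real q * real s + 1) ^ (4 * t * k + k)" using K_pos by simp
    show "0 < (\<Prod>u\<in>{- int J..int J}. real q * real s + of_int u - 1) * (y ^ J * D)"
      by (rule mult_pos_pos[OF less_le_trans[OF D le] D])
  qed
  also have "\<dots> = fact (2 * J) * (W ^ k * (real q * real s + 1) ^ (4 * t * k + k)) / (y ^ J * D)"
    by (simp add: K_def)
  also have "\<dots> \<le> fact (2 * J) * (real q ^ (17 * t * k) * y ^ (5 * t * k)) / (y ^ J * D)"
    using tail_numerator[OF assms] less_imp_le[OF D]
    unfolding y_def[symmetric] by (intro divide_right_mono mult_left_mono) simp_all
  also have "\<dots> = (fact (2 * J) / D) * (real q ^ (17 * t * k) / (y\<^sup>2 * y ^ r))"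
  proof -
    have "y ^ J = y ^ (5 * t * k) * (y\<^sup>2 * y ^ r)" by (simp only: J power_add mult.assoc)
    then show ?thesis using y by simp
  qed
  also have "\<dots> \<le> M * (1 / (2 * (real s)\<^sup>2))"
  proof (rule mult_mono)
    have "fact (2 * J) / D * 1 \<le> fact (2 * J) / D * (real q * real t)"
      using qt_ge D_pos by (intro mult_left_mono) auto
    then show "fact (2 * J) / D \<le> M" using M_ge by simp
    have "real q ^ (17 * t * k) * (2 * (real t)\<^sup>2) \<le> real q ^ (17 * t * k) * real q ^ (7 * t * k)"
    proof (rule mult_left_mono)
      have "2 * (real t)\<^sup>2 = 2 * (real t * real t)" by (simp add: power2_eq_square)
      also have "\<dots> \<le> real q ^ 1 * (real q ^ t * real q ^ t)"
        using q nat_le_q_power[of t] by (intro mult_mono) auto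
      also have "\<dots> = real q ^ (1 + (t + t))" by (simp only: power_add)
      also have "\<dots> \<le> real q ^ (7 * t * k)"
      proof (rule power_increasing)
        have "t * 1 \<le> t * k" using k by (intro mult_left_mono) auto
        moreover have "7 * t * k = 7 * (t * k)" by simp
        ultimately show "1 + (t + t) \<le> 7 * t * k" using t by linarith
      qed (use q in simp)
      finally show "2 * (real t)\<^sup>2 \<le> real q ^ (7 * t * k)" .
    qed simp
    also have "\<dots> = real q ^ (24 * t * k)"
    proof -
      have "17 * t * k + 7 * t * k = 24 * t * k" by simp
      then show ?thesis by (simp only: flip: power_add)
    qed
    also have "\<dots> \<le> y ^ r" using r power_mono[OF y, of r] by simp
    finally have "real q ^ (17 * t * k) \<le> y ^ r / (2 * (real t)\<^sup>2)" using t by (simp add: field_simps)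
    then have "real q ^ (17 * t * k) / (y\<^sup>2 * y ^ r) \<le> (y ^ r / (2 * (real t)\<^sup>2)) / (y\<^sup>2 * y ^ r)"
      by (rule divide_right_mono) (use y in simp)
    also have "\<dots> = 1 / (2 * (real s)\<^sup>2)" using y t assms by (simp add: y_def power_divide)
    finally show "real q ^ (17 * t * k) / (y\<^sup>2 * y ^ r) \<le> 1 / (2 * (real s)\<^sup>2)" .
  qed (use M_pos y in auto)
  finally show ?thesis by simp
qed

definition Lam :: real where "Lam = (\<Sum>m. fsum (n + 1 + m))"

lemma Lam_approx: "(\<lambda>m. fsum (n + 1 + m)) sums Lam" "\<bar>Lam - fsum t\<bar> \<le> M / 2"
proof -
  define l where "l = t - n - 1"
  have l: "n + 1 + l = t" using nt n by (simp add: l_def)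
  \<comment> \<open>\<open>g\<close> keeps only the term s = t, which has index l, and
    \<open>e\<close> is a telescoping majorant of the rest with sum M / 2.\<close>
  define g where "g m = (if m = l then fsum t else 0)" for m
  define e where "e m = M / 2 * (1 / real (Suc m) - 1 / real (Suc (Suc m)))" for m
  have bound: "norm (fsum (n + 1 + m) - g m) \<le> e m" for m
  proof -
    have e0: "0 \<le> e m" using M_pos by (auto simp: e_def field_simps)
    consider "m = l" | "m \<noteq> l" "n + 1 + m \<le> 2 * t" | "2 * t < n + 1 + m" by linarith
    then show ?thesis
    proof cases
      case 1
      then show ?thesis using l e0 by (simp add: g_def)
    next
      case 2
      then show ?thesis using fsum_zero[of "n + 1 + m"] e0 l by (auto simp: g_def)
    next
      case 3
      have "norm (fsum (n + 1 + m) - g m) = \<bar>fsum (n + 1 + m)\<bar>" using 3 l by (auto simp: g_def)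
      also have "\<dots> \<le> M / 2 * (1 / (real (n + 1 + m))\<^sup>2)" using 3 by (rule abs_fsum_tail)
      also have "\<dots> \<le> M / 2 * (1 / (real (Suc m) * real (Suc (Suc m))))"
      proof -
        have "real (Suc m) * real (Suc (Suc m)) \<le> real (n + 1 + m) * real (n + 1 + m)"
          using n by (intro mult_mono) auto
        then have "1 / (real (n + 1 + m))\<^sup>2 \<le> 1 / (real (Suc m) * real (Suc (Suc m)))"
          unfolding power2_eq_square by (intro divide_left_mono) auto
        then show ?thesis using M_pos by (intro mult_left_mono) auto
      qed
      also have "\<dots> = e m" unfolding e_def by (simp add: field_simps)
      finally show ?thesis .
    qed
  qed
  have e: "e sums (M / 2)" using sums_mult[OF sums_reciprocal_products, of "M / 2"]
    by (simp only: e_def[abs_def] mult_1_right)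
  have g: "g sums fsum t" using sums_single[of l "\<lambda>_. fsum t"] by (simp only: g_def[abs_def])
  have summ: "summable (\<lambda>m. fsum (n + 1 + m) - g m)"
    by (rule summable_comparison_test'[OF sums_summable[OF e], of 0]) (rule bound)
  have "(\<lambda>m. (fsum (n + 1 + m) - g m) + g m) sums ((\<Sum>m. fsum (n + 1 + m) - g m) + fsum t)"
    by (rule sums_add[OF summable_sums[OF summ] g])
  then have s: "(\<lambda>m. fsum (n + 1 + m)) sums ((\<Sum>m. fsum (n + 1 + m) - g m) + fsum t)" by simp
  then have Lam: "Lam = (\<Sum>m. fsum (n + 1 + m) - g m) + fsum t" unfolding Lam_def by (rule sums_unique[symmetric])
  show "(\<lambda>m. fsum (n + 1 + m)) sums Lam" unfolding Lam by (rule s)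
  have "norm (\<Sum>m. fsum (n + 1 + m) - g m) \<le> (\<Sum>m. e m)"
    by (rule norm_suminf_le[OF bound sums_summable[OF e]])
  also have "\<dots> = M / 2" by (rule sums_unique[OF e, symmetric])
  finally show "\<bar>Lam - fsum t\<bar> \<le> M / 2" unfolding Lam by simp
qed

lemma Lam_bounds: "M \<le> 2 * \<bar>Lam\<bar>" "\<bar>Lam\<bar> \<le> 2 * M"
  using Lam_approx(2) M_pos unfolding M_def by linarith+

end

section \<open>Linear forms in the values of the Hurwitz zeta function\<close>

context hurwitz_form_large
begin

definition rho :: "nat \<Rightarrow> real" where
  "rho a = (\<Sum>m\<in>{- int n..<int n}. cf (int q * m + int a))"

text \<open>The rational parts split off from the Hurwitz series; the factor 2 anticipates the
  symmetrization under a -> q - a.\<close>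

definition rho0 :: real where
  "rho0 = - 2 * (\<Sum>a\<in>{1..<q}. \<Sum>m\<in>{- int n..<int n}. cf (int q * m + int a) *
     (\<Sum>i<nat (int n + 1 + m). real q ^ k / (real q * real i + real a) ^ k))"

lemma index_bound:
  assumes "a \<in> {1..<q}" "m \<in> {- int n..<int n}"
  shows "\<bar>int q * m + int a\<bar> \<le> int J"
proof -
  have "int q * m \<le> int q * (int n - 1)" using assms by (intro mult_left_mono) auto
  moreover have "int q * (- int n) \<le> int q * m" using assms by (intro mult_left_mono) auto
  ultimately show ?thesis using assms by (auto simp: J_def abs_le_iff right_diff_distrib)
qed

lemma sum_residues:
  fixes F :: "int \<Rightarrow> real"
  assumes "\<And>j. j \<in> {- int J..int J} \<Longrightarrow> int q dvd j \<Longrightarrow> F j = 0"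
  shows "(\<Sum>j\<in>{- int J..int J}. F j) = (\<Sum>a\<in>{1..<q}. \<Sum>m\<in>{- int n..<int n}. F (int q * m + int a))"
proof -
  have q0: "q > 0" using q by simp
  have Jq: "int J = int q * int n" by (simp add: J_def)
  have "(\<Sum>j\<in>{- int J..int J}. F j) = (\<Sum>j\<in>{j \<in> {- int J..int J}. \<not> int q dvd j}. F j)"
    using assms by (intro sum.mono_neutral_right) auto
  also have "\<dots> = (\<Sum>(a, m)\<in>{1..<q} \<times> {- int n..<int n}. F (int q * m + int a))"
  proof (rule sum.reindex_bij_witness[of _ "\<lambda>(a, m). int q * m + int a" "\<lambda>j. (nat (j mod int q), j div int q)"])
    fix j assume "j \<in> {j \<in> {- int J..int J}. \<not> int q dvd j}"
    then have j: "- int J \<le> j" "j \<le> int J" "j mod int q \<noteq> 0" by (auto simp: dvd_eq_mod_eq_0)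
    have "0 \<le> j mod int q" "j mod int q < int q" using q0 by simp_all
    with j(3) have r: "0 < j mod int q" "j mod int q < int q" by simp_all
    have eq: "int q * (j div int q) + j mod int q = j" by simp
    have "int q * (j div int q) < int q * int n" using eq r j Jq by linarith
    then have 1: "j div int q < int n" using q0 by (simp add: mult_less_cancel_left)
    have "int q * (- int n - 1) = - int J - int q" by (simp add: J_def right_diff_distrib)
    then have "int q * (- int n - 1) < int q * (j div int q)" using eq r j by linarith
    then have 2: "- int n - 1 < j div int q" using q0 by (simp add: mult_less_cancel_left)
    have 3: "1 \<le> nat (j mod int q)" using r(1) by linarith
    have 4: "nat (j mod int q) < q" using r by linarith
    have 5: "- int n \<le> j div int q" using 2 by linarith
    show "(nat (j mod int q), j div int q) \<in> {1..<q} \<times> {- int n..<int n}"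
      unfolding mem_Sigma_iff atLeastLessThan_iff using 1 3 4 5 by blast
    have 6: "int (nat (j mod int q)) = j mod int q" using r(1) by (intro nat_0_le) linarith
    show "(case (nat (j mod int q), j div int q) of (a, m) \<Rightarrow> int q * m + int a) = j"
      by (simp only: prod.case 6 eq)
    show "(case (nat (j mod int q), j div int q) of (a, m) \<Rightarrow> F (int q * m + int a)) = F j"
      by (simp only: prod.case 6 eq)
  next
    fix x assume "x \<in> {1..<q} \<times> {- int n..<int n}"
    then obtain a m where x: "x = (a, m)" "a \<in> {1..<q}" "m \<in> {- int n..<int n}" by auto
    have mod: "(int q * m + int a) mod int q = int a" using x by simp
    have div: "(int q * m + int a) div int q = m" using x q0 by simp
    have "\<not> int q dvd int q * m + int a" using mod x by (auto simp: dvd_eq_mod_eq_0)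
    then show "(case x of (a, m) \<Rightarrow> int q * m + int a) \<in> {j \<in> {- int J..int J}. \<not> int q dvd j}"
      using index_bound[OF x(2,3)] x by (auto simp: abs_le_iff)
    show "(nat ((case x of (a, m) \<Rightarrow> int q * m + int a) mod int q), (case x of (a, m) \<Rightarrow> int q * m + int a) div int q) = x"
      using mod div x by simp
  qed
  also have "\<dots> = (\<Sum>a\<in>{1..<q}. \<Sum>m\<in>{- int n..<int n}. F (int q * m + int a))"
    by (simp add: sum.cartesian_product)
  finally show ?thesis .
qed

text \<open>Since m >= -n, the shift n + 1 + m is positive, so the series is a genuine tail of the
  Hurwitz series.\<close>

lemma shifted_series:
  assumes "a \<in> {1..<q}" "m \<in> {- int n..<int n}"
  shows "(\<lambda>i. real q ^ k / (real q * real (n + 1 + i) + of_int (int q * m + int a)) ^ k) sums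
     (hurwitz_zeta (real k) (real a / real q) - (\<Sum>i<nat (int n + 1 + m). real q ^ k / (real q * real i + real a) ^ k))"
proof -
  define l where "l = nat (int n + 1 + m)"
  have l: "int l = int n + 1 + m" using assms by (simp add: l_def)
  have q0: "real q > 0" using q by simp
  have summand: "1 / (real i + real a / real q) ^ k = real q ^ k / (real q * real i + real a) ^ k" for i
  proof -
    have "real i + real a / real q = (real q * real i + real a) / real q"
      using q0 by (simp add: field_simps)
    then show ?thesis by (simp only: power_divide) simp
  qed
  have "(\<lambda>i. 1 / (real i + real a / real q) ^ k) sums hurwitz_zeta (real k) (real a / real q)"
    using k assms q0 by (intro hurwitz_zeta_sums) auto
  then have "(\<lambda>i. real q ^ k / (real q * real i + real a) ^ k) sums hurwitz_zeta (real k) (real a / real q)"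
    by (simp only: summand)
  then have "(\<lambda>i. real q ^ k / (real q * real (i + l) + real a) ^ k) sums
      (hurwitz_zeta (real k) (real a / real q) - (\<Sum>i<l. real q ^ k / (real q * real i + real a) ^ k))"
    by (rule sums_split_initial_segment)
  moreover have "real q * real (i + l) + real a = real q * real (n + 1 + i) + of_int (int q * m + int a)" for i
  proof -
    have "real l = real n + 1 + of_int m" using arg_cong[OF l, of real_of_int] by simp
    then show ?thesis by (simp add: algebra_simps)
  qed
  ultimately show ?thesis by (simp only: l_def)
qed

lemma Lam_eq: "2 * real q ^ k * Lam = rho0 + 2 * (\<Sum>a\<in>{1..<q}. rho a * hurwitz_zeta (real k) (real a / real q))"
proof -
  let ?z = "\<lambda>a. hurwitz_zeta (real k) (real a / real q)"
  let ?f = "\<lambda>a m. \<Sum>i<nat (int n + 1 + m). real q ^ k / (real q * real i + real a) ^ k"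
  have "fsum s = (\<Sum>a\<in>{1..<q}. \<Sum>m\<in>{- int n..<int n}. cf (int q * m + int a) / (real q * real s + of_int (int q * m + int a)) ^ k)" for s
    unfolding fsum_def by (rule sum_residues) (simp add: cf_multiple_q abs_le_iff)
  then have "real q ^ k * fsum s = (\<Sum>a\<in>{1..<q}. \<Sum>m\<in>{- int n..<int n}. cf (int q * m + int a) * (real q ^ k / (real q * real s + of_int (int q * m + int a)) ^ k))" for s
    by (simp add: sum_distrib_left mult_ac)
  moreover have "(\<lambda>i. \<Sum>a\<in>{1..<q}. \<Sum>m\<in>{- int n..<int n}. cf (int q * m + int a) * (real q ^ k / (real q * real (n + 1 + i) + of_int (int q * m + int a)) ^ k)) sums
      (\<Sum>a\<in>{1..<q}. \<Sum>m\<in>{- int n..<int n}. cf (int q * m + int a) * (?z a - ?f a m))"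
    by (intro sums_sum sums_mult shifted_series)
  ultimately have "(\<lambda>i. real q ^ k * fsum (n + 1 + i)) sums (\<Sum>a\<in>{1..<q}. \<Sum>m\<in>{- int n..<int n}. cf (int q * m + int a) * (?z a - ?f a m))"
    by simp
  moreover have "(\<lambda>i. real q ^ k * fsum (n + 1 + i)) sums (real q ^ k * Lam)"
    by (rule sums_mult[OF Lam_approx(1)])
  ultimately have "real q ^ k * Lam = (\<Sum>a\<in>{1..<q}. \<Sum>m\<in>{- int n..<int n}. cf (int q * m + int a) * (?z a - ?f a m))"
    by (rule sums_unique2[rotated])
  also have "\<dots> = (\<Sum>a\<in>{1..<q}. rho a * ?z a) - (\<Sum>a\<in>{1..<q}. \<Sum>m\<in>{- int n..<int n}. cf (int q * m + int a) * ?f a m)"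
    by (simp only: rho_def right_diff_distrib sum_subtractf sum_distrib_right)
  finally show ?thesis by (simp add: rho0_def)
qed

lemma rho_reflect:
  assumes "a \<in> {1..<q}"
  shows "rho (q - a) = (-1) ^ (k + 1) * rho a"
proof -
  have "rho (q - a) = (\<Sum>m\<in>{- int n..<int n}. cf (- (int q * m + int a)))"
    unfolding rho_def
    by (rule sum.reindex_bij_witness[of _ "\<lambda>m. - m - 1" "\<lambda>m. - m - 1"])
      (use assms in \<open>auto simp: of_nat_diff algebra_simps\<close>)
  also have "\<dots> = (\<Sum>m\<in>{- int n..<int n}. (-1) ^ (k + 1) * cf (int q * m + int a))"
    by (intro sum.cong refl cf_reflect index_bound assms)
  finally show ?thesis by (simp only: rho_def sum_distrib_left)
qed

text \<open>Averaging over a and q - a combines the Hurwitz values into zeta^-, because the residue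
  sums have parity k + 1.\<close>

lemma Lam_linear_form:
  "2 * real q ^ k * Lam = rho0 + (\<Sum>a\<in>{1..<q}. rho a * hurwitz_zeta_minus k (real a / real q))"
proof -
  let ?z = "hurwitz_zeta (real k)"
  have "(\<Sum>a\<in>{1..<q}. rho a * ?z (real a / real q)) = (\<Sum>a\<in>{1..<q}. rho (q - a) * ?z (real (q - a) / real q))"
    by (rule sum.reindex_bij_witness[of _ "\<lambda>a. q - a" "\<lambda>a. q - a"]) auto
  also have "\<dots> = (\<Sum>a\<in>{1..<q}. (-1) ^ (k + 1) * rho a * ?z (1 - real a / real q))"
  proof (intro sum.cong refl)
    fix a assume a: "a \<in> {1..<q}"
    have "real (q - a) / real q = 1 - real a / real q" using a by (simp add: of_nat_diff field_simps)
    then show "rho (q - a) * ?z (real (q - a) / real q) = (-1) ^ (k + 1) * rho a * ?z (1 - real a / real q)"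
      using rho_reflect[OF a] by simp
  qed
  finally have "2 * (\<Sum>a\<in>{1..<q}. rho a * ?z (real a / real q)) =
      (\<Sum>a\<in>{1..<q}. rho a * ?z (real a / real q)) + (\<Sum>a\<in>{1..<q}. (-1) ^ (k + 1) * rho a * ?z (1 - real a / real q))"
    by simp
  also have "\<dots> = (\<Sum>a\<in>{1..<q}. rho a * hurwitz_zeta_minus k (real a / real q))"
    unfolding sum.distrib[symmetric] by (intro sum.cong refl) (simp add: hurwitz_zeta_minus_def algebra_simps)
  finally show ?thesis unfolding Lam_eq by simp
qed

lemma rho_integral:
  assumes "a \<in> {1..<q}"
  shows "rho a \<in> \<int>"
  unfolding rho_def by (intro Ints_sum cf_integral index_bound assms)

lemma rho_bound:
  assumes "a \<in> {1..<q}"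
  shows "\<bar>rho a\<bar> \<le> 4 ^ J * real q ^ (25 * t * k)"
proof -
  have "\<bar>rho a\<bar> \<le> (\<Sum>m\<in>{- int n..<int n}. 4 ^ J * real q ^ (24 * t * k))"
    unfolding rho_def by (rule order.trans[OF sum_abs]) (intro sum_mono cf_bound index_bound assms)
  also have "\<dots> = 4 ^ J * (real (2 * n) * real q ^ (24 * t * k))" by simp
  also have "\<dots> \<le> 4 ^ J * (real q ^ (t * k) * real q ^ (24 * t * k))"
  proof (intro mult_left_mono mult_right_mono)
    have "real (2 * n) \<le> real t" using nt by simp
    also have "\<dots> \<le> real q ^ t" by (rule nat_le_q_power)
    also have "\<dots> \<le> real q ^ (t * k)"
    proof (rule power_increasing)
      show "t \<le> t * k" using k by simp
    qed (use q in simp)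
    finally show "real (2 * n) \<le> real q ^ (t * k)" .
  qed simp_all
  also have "\<dots> = 4 ^ J * real q ^ (25 * t * k)"
  proof -
    have "t * k + 24 * t * k = 25 * t * k" by simp
    then show ?thesis by (simp only: flip: power_add)
  qed
  finally show ?thesis .
qed

text \<open>The denominators q i + a have i <= 2n - 1 and a < q, hence lie below 2J.\<close>

lemma rho0_integral: "of_nat (Lcm {1..2 * J} ^ k) * rho0 \<in> \<int>"
proof -
  have "of_nat (Lcm {1..2 * J} ^ k) * (real q ^ k / (real q * real i + real a) ^ k) \<in> \<int>"
    if a: "a \<in> {1..<q}" and m: "m \<in> {- int n..<int n}" and i: "i < nat (int n + 1 + m)" for a m i
  proof -
    have "i + 1 \<le> 2 * n" using m i by auto
    then have "q * (i + 1) \<le> q * (2 * n)" by (rule mult_left_mono) simp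
    then have "q * i + a \<in> {1..2 * J}" using a by (auto simp: J_def)
    then have "q * i + a dvd Lcm {1..2 * J}" by (rule dvd_Lcm)
    then obtain w where w: "Lcm {1..2 * J} = (q * i + a) * w" by auto
    have "of_nat (Lcm {1..2 * J} ^ k) * (real q ^ k / (real q * real i + real a) ^ k) = of_nat (w ^ k * q ^ k)"
    proof -
      have "0 < real q * real i + real a" using a by (intro add_nonneg_pos) auto
      then show ?thesis unfolding w by (simp add: power_mult_distrib)
    qed
    then show ?thesis by (simp only: Ints_of_nat)
  qed
  then have "of_nat (Lcm {1..2 * J} ^ k) * (\<Sum>i<nat (int n + 1 + m). real q ^ k / (real q * real i + real a) ^ k) \<in> \<int>"
    if "a \<in> {1..<q}" "m \<in> {- int n..<int n}" for a m
    unfolding sum_distrib_left using that by (intro Ints_sum) auto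
  then have "cf (int q * m + int a) * (of_nat (Lcm {1..2 * J} ^ k) * (\<Sum>i<nat (int n + 1 + m). real q ^ k / (real q * real i + real a) ^ k)) \<in> \<int>"
    if "a \<in> {1..<q}" "m \<in> {- int n..<int n}" for a m
    using that by (intro Ints_mult[OF cf_integral[OF index_bound]]) auto
  then have "(\<Sum>a\<in>{1..<q}. \<Sum>m\<in>{- int n..<int n}. cf (int q * m + int a) * (of_nat (Lcm {1..2 * J} ^ k) * (\<Sum>i<nat (int n + 1 + m). real q ^ k / (real q * real i + real a) ^ k))) \<in> \<int>"
    by (intro Ints_sum) auto
  then have "of_int (-2) * (\<Sum>a\<in>{1..<q}. \<Sum>m\<in>{- int n..<int n}. cf (int q * m + int a) * (of_nat (Lcm {1..2 * J} ^ k) * (\<Sum>i<nat (int n + 1 + m). real q ^ k / (real q * real i + real a) ^ k))) \<in> \<int>"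
    by (rule Ints_mult[OF Ints_of_int])
  also have "of_int (-2) * (\<Sum>a\<in>{1..<q}. \<Sum>m\<in>{- int n..<int n}. cf (int q * m + int a) * (of_nat (Lcm {1..2 * J} ^ k) * (\<Sum>i<nat (int n + 1 + m). real q ^ k / (real q * real i + real a) ^ k)))
      = of_nat (Lcm {1..2 * J} ^ k) * rho0"
    unfolding rho0_def sum_distrib_left by (intro sum.cong refl) simp
  finally show ?thesis .
qed

end

section \<open>Lower bound for the dimension\<close>

lemma V_minus_dim_lower_bound:
  fixes k q r :: nat
  assumes k: "k \<ge> 2" and q: "q \<ge> 16" and r: "r \<ge> 4" and big: "q ^ (30 * k * r) \<le> 2 ^ q" and qr: "2 * q \<le> r\<^sup>2"
  shows "2 * real q * (1 + ln (real r / 2)) - 25 * real k * real r * ln (real q) - 2 * real q * real k * ln 16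
    \<le> real (rat_dim (V_minus k q)) * (2 * real q * ln 2 + 50 * real k * real r * ln (real q) + ln 2)"
    (is "?lhs \<le> ?d * ?rhs")
proof (rule ccontr)
  assume "\<not> ?lhs \<le> ?d * ?rhs"
  then have neg: "?d * ?rhs < ?lhs" by simp
  define X where "X = {hurwitz_zeta_minus k (real a / real q) | a. 1 \<le> a \<and> real a < real q / 2 \<and> coprime a q}"
  have V: "V_minus k q = rat_span X" unfolding V_minus_def X_def ..
  define Lm where "Lm n = hurwitz_form_large.Lam k q (r * n) n" for n
  define ro where "ro n = hurwitz_form_large.rho k q (r * n) n" for n
  define ro0 where "ro0 n = hurwitz_form_large.rho0 k q (r * n) n" for n
  have loc: "hurwitz_form_large k q (r * n) n" if n: "n \<ge> 1" for n
  proof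
    show "k \<ge> 2" "q \<ge> 16" "n \<ge> 1" by (fact k q n)+
    show "4 * n \<le> r * n" using r by simp
    have "(q ^ (30 * k * r)) ^ n \<le> (2 ^ q) ^ n" by (intro power_mono big) simp
    then show "q ^ (30 * (r * n) * k) \<le> 2 ^ (q * n)" by (simp add: mult_ac flip: power_mult)
    show "2 * q * n\<^sup>2 \<le> (r * n)\<^sup>2" unfolding power_mult_distrib using qr by (intro mult_right_mono) auto
  qed
  \<comment> \<open>Rates per unit of n: |Lam| lies between 1 / (2 B^n) and 12 (E / B)^n, and the
    coefficients are at most H^n. The 24 in \<open>C\<close> is 2 * 12, the forms being multiplied
    by 2 q^k.\<close>
  define B where "B = (exp 1 * real r / 2) ^ (2 * q)"
  define E where "E = real q ^ (25 * r * k)"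
  define H where "H = 4 ^ q * E"
  define C where "C = 24 * real q ^ k"
  have E: "E \<ge> 1" unfolding E_def using q by (intro one_le_power) auto
  have B: "B > 0" using r by (simp add: B_def)
  have Jn: "hurwitz_form.J q n = q * n" if "n \<ge> 1" for n
    using loc[OF that] hurwitz_form.J_def[of k q "r * n" n] by (simp add: hurwitz_form_large_def)
  have En: "real q ^ (25 * (r * n) * k) = E ^ n" for n
    unfolding E_def by (simp add: mult_ac flip: power_mult)
  have Bn: "(2 * real n / (exp 1 * real (r * n))) ^ (2 * (q * n)) = 1 / B ^ n" if "n \<ge> 1" for n
  proof -
    have "2 * real n / (exp 1 * real (r * n)) = 1 / (exp 1 * real r / 2)" using that by simp
    then have "(2 * real n / (exp 1 * real (r * n))) ^ (2 * (q * n)) = (1 / (exp 1 * real r / 2)) ^ (2 * q * n)"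
      by (simp only: mult.assoc)
    also have "\<dots> = 1 / B ^ n" unfolding B_def by (simp only: power_one_over power_mult)
    finally show ?thesis .
  qed
  have qk: "1 \<le> real q ^ k" using q by (intro one_le_power) auto
  have ln2: "ln (4 :: real) = 2 * ln 2" "ln (16 :: real) = 4 * ln 2"
    using ln_realpow[of 2 2] ln_realpow[of 2 4] by simp_all
  have lnx: "ln (2 * H * E) = ?rhs"
    using q E unfolding H_def by (simp add: ln_mult ln_realpow ln2 E_def) 
  have lnA: "ln (B / E) = 2 * real q * (1 + ln (real r / 2)) - 25 * real k * real r * ln (real q)"
  proof -
    have "exp 1 * real r / 2 = exp 1 * (real r / 2)" by simp
    then show ?thesis using B E q r by (simp add: ln_div B_def E_def ln_realpow ln_mult)
  qed
  show False
  \<comment> \<open>With A = B / E, the condition \<open>H * B < x * A\<close> demands x > H E; the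
    factor 2 makes it strict.\<close>
  proof (rule linear_forms_dim_criterion[where X = X and I = "{1..<q}" and \<xi> = "\<lambda>a. hurwitz_zeta_minus k (real a / real q)"
        and \<Lambda> = "\<lambda>n. 2 * real q ^ k * Lm n" and \<rho> = ro0 and c = "\<lambda>n a. \<lfloor>ro n a\<rfloor>"
        and \<delta> = "\<lambda>n. Lcm {1..2 * (q * n)} ^ k" and A = "B / E" and B = B and C = C and G = "16 ^ (2 * q * k)" and H = H
        and x = "2 * H * E"])
    show "finite X"
      by (rule finite_subset[of _ "(\<lambda>a. hurwitz_zeta_minus k (real a / real q)) ` {..q}"]) (auto simp: X_def)
    show "hurwitz_zeta_minus k (real a / real q) \<in> rat_span X" if "a \<in> {1..<q}" for a
      using hurwitz_zeta_minus_in_V_minus[of k q a] that k q unfolding V by auto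
    show "Lcm {1..2 * (q * m)} ^ k dvd (Lcm {1..2 * (q * n)} ^ k :: nat)" if "m \<le> n" for m n
      using that by (intro dvd_power_same Lcm_subset) auto
    show "0 < (Lcm {1..2 * (q * n)} ^ k :: nat)" for n
      using Lcm_atLeastAtMost_pos by simp
    fix n :: nat assume n: "n \<ge> 1"
    interpret hurwitz_form_large k q "r * n" n by (rule loc[OF n])
    have M1: "M \<ge> 1 / B ^ n" using M_lower unfolding Jn[OF n] Bn[OF n] .
    have M2: "M \<le> 6 * E ^ n / B ^ n" using M_upper unfolding Jn[OF n] Bn[OF n] En by simp
    have fl: "of_int \<lfloor>ro n a\<rfloor> = ro n a" if "a \<in> {1..<q}" for a
      using rho_integral[OF that] unfolding ro_def by (metis Ints_cases floor_of_int)
    show "2 * real q ^ k * Lm n = ro0 n + (\<Sum>a\<in>{1..<q}. of_int \<lfloor>ro n a\<rfloor> * hurwitz_zeta_minus k (real a / real q))"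
    proof -
      have "(\<Sum>a\<in>{1..<q}. of_int \<lfloor>ro n a\<rfloor> * hurwitz_zeta_minus k (real a / real q)) =
          (\<Sum>a\<in>{1..<q}. rho a * hurwitz_zeta_minus k (real a / real q))"
        by (intro sum.cong refl) (simp only: fl, simp only: ro_def)
      then show ?thesis using Lam_linear_form unfolding Lm_def ro0_def by simp
    qed
    show "of_nat (Lcm {1..2 * (q * n)} ^ k) * ro0 n \<in> \<int>"
      using rho0_integral unfolding ro0_def Jn[OF n] .
    show "\<bar>of_int \<lfloor>ro n a\<rfloor>\<bar> \<le> C * H ^ n" if "a \<in> {1..<q}" for a
    proof -
      have "\<bar>of_int \<lfloor>ro n a\<rfloor>\<bar> \<le> 4 ^ (q * n) * E ^ n"
        unfolding fl[OF that] using rho_bound[OF that] unfolding ro_def Jn[OF n] En .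
      also have "\<dots> = H ^ n" by (simp only: H_def power_mult_distrib power_mult)
      also have "\<dots> \<le> C * H ^ n"
        using qk E mult_right_mono[of 1 C "H ^ n"] by (simp add: C_def H_def)
      finally show ?thesis .
    qed
    show "real (Lcm {1..2 * (q * n)} ^ k) \<le> C * (16 ^ (2 * q * k)) ^ n"
    proof -
      have "Lcm {1..2 * (q * n)} ^ k \<le> ((16 :: nat) ^ (2 * (q * n))) ^ k"
        by (intro power_mono Lcm_atLeastAtMost_le) simp
      then have "real (Lcm {1..2 * (q * n)} ^ k) \<le> real (((16 :: nat) ^ (2 * (q * n))) ^ k)" by (rule of_nat_mono)
      also have "\<dots> = (16 ^ (2 * q * k)) ^ n" by (simp add: mult_ac flip: power_mult)
      also have "\<dots> \<le> C * (16 ^ (2 * q * k)) ^ n"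
        using qk mult_right_mono[of 1 C "(16 ^ (2 * q * k)) ^ n"] by (simp add: C_def)
      finally show ?thesis .
    qed
    show "1 \<le> C * B ^ n * \<bar>2 * real q ^ k * Lm n\<bar>"
    proof -
      have "1 = B ^ n * (1 / B ^ n)" using B by simp
      also have "\<dots> \<le> B ^ n * (2 * \<bar>Lm n\<bar>)"
        using B M1 Lam_bounds(1) unfolding Lm_def by (intro mult_left_mono) auto
      also have "\<dots> \<le> (C * real q ^ k) * (B ^ n * (2 * \<bar>Lm n\<bar>))"
      proof -
        have "1 * 1 \<le> C * real q ^ k" using qk by (intro mult_mono) (auto simp: C_def)
        then show ?thesis using B mult_right_mono[of 1 "C * real q ^ k" "B ^ n * (2 * \<bar>Lm n\<bar>)"] by simp
      qed
      also have "\<dots> = C * B ^ n * \<bar>2 * real q ^ k * Lm n\<bar>" by (simp add: abs_mult)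
      finally show ?thesis .
    qed
    show "\<bar>2 * real q ^ k * Lm n\<bar> * (B / E) ^ n \<le> C"
    proof -
      have "\<bar>2 * real q ^ k * Lm n\<bar> * (B / E) ^ n = 2 * real q ^ k * \<bar>Lm n\<bar> * (B / E) ^ n"
        by (simp add: abs_mult)
      also have "\<dots> \<le> 2 * real q ^ k * (2 * (6 * E ^ n / B ^ n)) * (B / E) ^ n"
        using M2 Lam_bounds(2) B E unfolding Lm_def by (intro mult_right_mono mult_left_mono) auto
      also have "\<dots> = C" using B E by (simp add: C_def power_divide)
      finally show ?thesis .
    qed
  next
    have H1: "1 \<le> H" unfolding H_def using E mult_mono[of 1 "4 ^ q" 1 E] by simp
    then show "1 \<le> H" .
    show "1 \<le> C" using qk by (simp add: C_def)
    show "(1 :: real) \<le> 16 ^ (2 * q * k)" by (intro one_le_power) simp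
    show "0 < B / E" using B E by simp
    show "B / E \<le> B" using B E by (simp add: divide_le_eq)
    have "1 * 1 \<le> H * E" using H1 E by (intro mult_mono) auto
    then show x1: "1 \<le> 2 * H * E" by simp
    show "H * B < 2 * H * E * (B / E)" using H1 B E by simp
    have "ln ((2 * H * E) ^ rat_dim (rat_span X) * 16 ^ (2 * q * k)) = ?d * ?rhs + 2 * real q * real k * ln 16"
    proof -
      have "ln (y ^ m * 16 ^ (2 * q * k)) = real m * ln y + 2 * real q * real k * ln 16" if "y > 0" for y m
        using that by (simp add: ln_mult ln_realpow)
      from this[of "2 * H * E" "rat_dim (rat_span X)"] show ?thesis using x1 by (simp only: lnx V)
    qed
    also have "\<dots> < ln (B / E)" using neg unfolding lnA by linarith
    finally show "(2 * H * E) ^ rat_dim (rat_span X) * 16 ^ (2 * q * k) < B / E"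
    proof (subst (asm) ln_less_cancel_iff)
      have p: "0 < 2 * H * E" using x1 by linarith
      show "0 < (2 * H * E) ^ rat_dim (rat_span X) * 16 ^ (2 * q * k)"
        by (rule mult_pos_pos[OF zero_less_power[OF p] zero_less_power]) simp
      show "0 < B / E" using B E by simp
    qed
  qed simp
qed

lemma V_minus_dim_asymptotic_bound:
  fixes k :: nat
  assumes k: "k \<ge> 2"
  shows "eventually (\<lambda>q. (2 * real q * (1 + ln ((real q / ln (real q) ^ 2 - 1) / 2)) - 25 * real k * real q / ln (real q) - 2 * real q * real k * ln 16)
    / (2 * real q * ln 2 + 50 * real k * real q / ln (real q) + ln 2) \<le> real (rat_dim (V_minus k q))) sequentially"
proof -
  have kpos: "real k > 0" using k by simp
  \<comment> \<open>After rounding down, these three facts yield in turn r >= 4, 2 q <= r^2 and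
    q^(30 k r) <= 2^q.\<close>
  have "eventually (\<lambda>q. 5 \<le> real q / ln (real q) ^ 2) sequentially" by real_asymp
  moreover have "eventually (\<lambda>q. 2 * real q \<le> (real q / ln (real q) ^ 2 - 1) ^ 2) sequentially" by real_asymp
  moreover have "eventually (\<lambda>q. 30 * real k * (real q / ln (real q)) \<le> real q * ln 2) sequentially"
    using kpos by real_asymp
  ultimately show ?thesis using eventually_ge_at_top[of 16]
  proof eventually_elim
    case (elim q)
    define r where "r = nat \<lfloor>real q / ln (real q) ^ 2\<rfloor>"
    have lnq: "ln (real q) > 0" using elim(4) by simp
    have "real q / ln (real q) ^ 2 \<ge> 0" by simp
    then have r: "real q / ln (real q) ^ 2 - 1 \<le> real r" "real r \<le> real q / ln (real q) ^ 2"
      unfolding r_def by linarith+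
    have r4: "r \<ge> 4" using r(1) elim(1) by linarith
    have rln: "real r * ln (real q) \<le> real q / ln (real q)"
    proof -
      have "real r * ln (real q) \<le> real q / ln (real q) ^ 2 * ln (real q)"
        using r lnq by (intro mult_right_mono) auto
      also have "\<dots> = real q / ln (real q)" using lnq by (simp add: power2_eq_square)
      finally show ?thesis .
    qed
    have "2 * real q \<le> real r ^ 2"
      using elim(2) power_mono[OF r(1), of 2] elim(1) by linarith
    then have qr: "2 * q \<le> r\<^sup>2"
      using of_nat_le_iff[of "2 * q" "r\<^sup>2", where ?'a = real] by simp
    have big: "q ^ (30 * k * r) \<le> 2 ^ q"
    proof -
      have "ln (real q ^ (30 * k * r)) = 30 * real k * (real r * ln (real q))"
        using elim(4) by (simp add: ln_realpow)
      also have "\<dots> \<le> 30 * real k * (real q / ln (real q))" using rln by (intro mult_left_mono) auto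
      also have "\<dots> \<le> ln (2 ^ q)" using elim(3) by (simp add: ln_realpow)
      finally have "real q ^ (30 * k * r) \<le> 2 ^ q"
        using elim(4) by (subst (asm) ln_le_cancel_iff) auto
      then show ?thesis using of_nat_le_iff[of "q ^ (30 * k * r)" "2 ^ q", where ?'a = real] by simp
    qed
    let ?d = "real (rat_dim (V_minus k q))"
    have krln: "real k * real r * ln (real q) \<le> real k * real q / ln (real q)"
      using mult_left_mono[OF rln, of "real k"] by (simp add: mult.assoc)
    have "2 * real q * (1 + ln ((real q / ln (real q) ^ 2 - 1) / 2)) - 25 * real k * real q / ln (real q) - 2 * real q * real k * ln 16
       \<le> 2 * real q * (1 + ln (real r / 2)) - 25 * real k * real r * ln (real q) - 2 * real q * real k * ln 16"
    proof -
      have "ln ((real q / ln (real q) ^ 2 - 1) / 2) \<le> ln (real r / 2)"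
      proof -
        have "ln ((z - 1) / 2) \<le> ln (w / 2)" if "z - 1 \<le> w" "5 \<le> z" for z w :: real
          using that by (subst ln_le_cancel_iff) auto
        from this[OF r(1) elim(1)] show ?thesis .
      qed
      then have "2 * real q * (1 + ln ((real q / ln (real q) ^ 2 - 1) / 2)) \<le> 2 * real q * (1 + ln (real r / 2))"
        by (intro mult_left_mono) auto
      then show ?thesis using krln by (simp add: mult.assoc)
    qed
    also have "\<dots> \<le> ?d * (2 * real q * ln 2 + 50 * real k * real r * ln (real q) + ln 2)"
      by (rule V_minus_dim_lower_bound[OF k elim(4) r4 big qr])
    also have "\<dots> \<le> ?d * (2 * real q * ln 2 + 50 * real k * real q / ln (real q) + ln 2)"
      using krln by (intro mult_left_mono) (simp_all add: mult.assoc)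
    finally have "2 * real q * (1 + ln ((real q / ln (real q) ^ 2 - 1) / 2)) - 25 * real k * real q / ln (real q) - 2 * real q * real k * ln 16
       \<le> ?d * (2 * real q * ln 2 + 50 * real k * real q / ln (real q) + ln 2)" .
    moreover have "0 < 2 * real q * ln 2 + 50 * real k * real q / ln (real q) + ln 2"
      using lnq by (intro add_nonneg_pos add_nonneg_nonneg) auto
    ultimately show ?case by (simp only: pos_divide_le_eq)
  qed
qed

theorem theorem1p5:
  fixes k :: nat
  assumes "k \<ge> 2"
  shows "\<exists>\<epsilon> :: nat \<Rightarrow> real. \<epsilon> \<longlonglongrightarrow> 0 \<and>
           (\<forall>q\<ge>3. real (rat_dim (V_minus k q)) \<ge> (1 / ln 2 - \<epsilon> q) * ln (real q))"
proof -
  define g where "g q = (2 * real q * (1 + ln ((real q / ln (real q) ^ 2 - 1) / 2)) - 25 * real k * real q / ln (real q) - 2 * real q * real k * ln 16)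
    / (2 * real q * ln 2 + 50 * real k * real q / ln (real q) + ln 2)" for q
  \<comment> \<open>This choice makes the inequality hold for every q >= 3, so only the limit
    remains; the maximum with 0 allows the lower bound for the dimension alone to squeeze
    it.\<close>
  define \<epsilon> where "\<epsilon> q = max 0 (1 / ln 2 - real (rat_dim (V_minus k q)) / ln (real q))" for q
  have kpos: "real k > 0" using assms by simp
  have lim: "(\<lambda>q. max 0 (1 / ln 2 - g q / ln (real q))) \<longlonglongrightarrow> max 0 (1 / ln 2 - 1 / ln 2)"
  proof (intro tendsto_max tendsto_diff tendsto_const)
    show "(\<lambda>q. g q / ln (real q)) \<longlonglongrightarrow> 1 / ln 2"
      unfolding g_def inverse_eq_divide[symmetric] using kpos by real_asymp
  qed
  have "\<epsilon> \<longlonglongrightarrow> 0"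
  proof (rule tendsto_sandwich[OF _ _ tendsto_const])
    show "eventually (\<lambda>q. 0 \<le> \<epsilon> q) sequentially" by (simp add: \<epsilon>_def)
    show "eventually (\<lambda>q. \<epsilon> q \<le> max 0 (1 / ln 2 - g q / ln (real q))) sequentially"
      using V_minus_dim_asymptotic_bound[OF assms] eventually_ge_at_top[of 3]
    proof eventually_elim
      case (elim q)
      have "g q / ln (real q) \<le> real (rat_dim (V_minus k q)) / ln (real q)"
        using elim by (intro divide_right_mono) (auto simp: g_def)
      then show ?case unfolding \<epsilon>_def by (intro max.mono) auto
    qed
    show "(\<lambda>q. max 0 (1 / ln 2 - g q / ln (real q))) \<longlonglongrightarrow> 0" using lim by simp
  qed
  moreover have "(1 / ln 2 - \<epsilon> q) * ln (real q) \<le> real (rat_dim (V_minus k q))" if "q \<ge> 3" for q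
  proof -
    have lnq: "ln (real q) > 0" using that by simp
    have "1 / ln 2 - \<epsilon> q \<le> real (rat_dim (V_minus k q)) / ln (real q)" by (simp add: \<epsilon>_def)
    then show ?thesis using lnq by (simp add: pos_le_divide_eq)
  qed
  ultimately show ?thesis by blast
qed

end
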